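(* Let $S\in\mathbb{R}^{2n\times2n}$ be a free symplectic matrix and $\hat S$ a metaplectic operator on $L^2(\mathbb{R}^n)$ with $\pi(\hat S)=S$. Then for every pair of sets $E,F\subset\mathbb{R}^n$ of finite measure there is a constant $C$ such that $$\|\phi\|_{L^2}\le C\left(\|\mathbf{1}_{E^c}\phi\|_{L^2}+\|\mathbf{1}_{F^c}\hat S\phi\|_{L^2}\right)\qquad\text{for all }\phi\in L^2(\mathbb{R}^n).$$
   Context: A matrix $S\in\mathbb{R}^{2n\times2n}$ is symplectic if $S^tJS=J$, where $J=\begin{pmatrix}0&I\\-I&0\end{pmatrix}$. Writing $S=\begin{pmatrix}A&B\\C&D\end{pmatrix}$ in $n\times n$ blocks, $S$ is called free if $B$ is invertible. For $(x,\xi)\in\mathbb{R}^{2n}$, $\tau\in\mathbb{R}$, the Schrödinger representation of the Heisenberg group is $\rho(x,\xi;\tau)\phi(y)=e^{2\pi i\tau}e^{-i\pi x\cdot\xi}e^{2\pi i\xi\cdot y}\phi(y-x)$ on $L^2(\mathbb{R}^n)$. A metaplectic operator $\hat S$ with projection $\pi(\hat S)=S$ is a unitary operator on $L^2(\mathbb{R}^n)$ (unique up to a constant phase factor) such that $\hat S\rho(x,\xi;\tau)\hat S^{-1}=\rho(S(x,\xi);\tau)$ for all $x,\xi,\tau$. $\mathbf{1}_E$ denotes (multiplication by) the characteristic function of $E$, and $E^c$ the complement of $E$. *)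

theory Defs
  imports "HOL-Analysis.Analysis"
begin

text \<open>
  Phase space is \<open>real ^ ('n + 'n)\<close>: a point \<open>(x, \<xi>)\<close> carries \<open>x\<close> in the \<open>Inl\<close> coordinates
  and \<open>\<xi>\<close> in the \<open>Inr\<close> coordinates.  Matrices are indexed row first.
\<close>

definition position :: "real ^ ('n + 'n) \<Rightarrow> real ^ 'n" where
  "position z = (\<chi> i. z $ Inl i)"

definition momentum :: "real ^ ('n + 'n) \<Rightarrow> real ^ 'n" where
  "momentum z = (\<chi> i. z $ Inr i)"

definition block_mat ::
    "real ^ 'n ^ 'n \<Rightarrow> real ^ 'n ^ 'n \<Rightarrow> real ^ 'n ^ 'n \<Rightarrow> real ^ 'n ^ 'n
      \<Rightarrow> real ^ ('n + 'n) ^ ('n + 'n)" where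
  "block_mat A B C D =
    (\<chi> i j. case i of
        Inl a \<Rightarrow> (case j of Inl b \<Rightarrow> A $ a $ b | Inr b \<Rightarrow> B $ a $ b)
      | Inr a \<Rightarrow> (case j of Inl b \<Rightarrow> C $ a $ b | Inr b \<Rightarrow> D $ a $ b))"

definition symplectic_J :: "real ^ ('n::finite + 'n) ^ ('n + 'n)" where
  "symplectic_J = block_mat 0 (mat 1) (- mat 1) 0"

definition symplectic :: "real ^ ('n::finite + 'n) ^ ('n + 'n) \<Rightarrow> bool" where
  "symplectic S \<longleftrightarrow> transpose S ** symplectic_J ** S = symplectic_J"

definition free_matrix :: "real ^ ('n::finite + 'n) ^ ('n + 'n) \<Rightarrow> bool" where
  "free_matrix S \<longleftrightarrow> (\<exists>A B C D. S = block_mat A B C D \<and> invertible B)"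

text \<open>
  Elements of \<open>L\<^sup>2\<close> are represented by functions; equality in \<open>L\<^sup>2\<close> is equality almost
  everywhere.  An operator on \<open>L\<^sup>2\<close> is accordingly a map on functions that respects this
  relation, and its values outside \<open>L2\<close> are irrelevant.
\<close>

definition L2 :: "('a::euclidean_space \<Rightarrow> complex) set" where
  "L2 = {f. f \<in> borel_measurable lebesgue \<and> integrable lebesgue (\<lambda>x. (norm (f x))\<^sup>2)}"

definition L2_eq :: "('a::euclidean_space \<Rightarrow> complex) \<Rightarrow> ('a \<Rightarrow> complex) \<Rightarrow> bool" where
  "L2_eq f g \<longleftrightarrow> (AE x in lebesgue. f x = g x)"

definition L2_inner :: "('a::euclidean_space \<Rightarrow> complex) \<Rightarrow> ('a \<Rightarrow> complex) \<Rightarrow> complex" where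
  "L2_inner f g = (LINT x|lebesgue. f x * cnj (g x))"

definition L2_norm :: "('a::euclidean_space \<Rightarrow> complex) \<Rightarrow> real" where
  "L2_norm f = sqrt (LINT x|lebesgue. (norm (f x))\<^sup>2)"

definition unitary_L2 ::
    "(('a::euclidean_space \<Rightarrow> complex) \<Rightarrow> ('a \<Rightarrow> complex)) \<Rightarrow> bool" where
  "unitary_L2 T \<longleftrightarrow>
     (\<forall>f\<in>L2. T f \<in> L2) \<and>
     (\<forall>f\<in>L2. \<forall>g\<in>L2. L2_eq f g \<longrightarrow> L2_eq (T f) (T g)) \<and>
     (\<forall>f\<in>L2. \<forall>g\<in>L2. L2_eq (T (\<lambda>x. f x + g x)) (\<lambda>x. T f x + T g x)) \<and>
     (\<forall>c. \<forall>f\<in>L2. L2_eq (T (\<lambda>x. c * f x)) (\<lambda>x. c * T f x)) \<and>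
     (\<forall>f\<in>L2. \<forall>g\<in>L2. L2_inner (T f) (T g) = L2_inner f g) \<and>
     (\<forall>g\<in>L2. \<exists>f\<in>L2. L2_eq (T f) g)"

text \<open>For unitary \<open>T\<close> the chosen preimage is unique up to equality almost everywhere.\<close>

definition L2_inverse ::
    "(('a::euclidean_space \<Rightarrow> complex) \<Rightarrow> ('a \<Rightarrow> complex)) \<Rightarrow> ('a \<Rightarrow> complex) \<Rightarrow> ('a \<Rightarrow> complex)" where
  "L2_inverse T g = (SOME f. f \<in> L2 \<and> L2_eq (T f) g)"

definition schroedinger_rep ::
    "real ^ ('n::finite + 'n) \<Rightarrow> real \<Rightarrow> (real ^ 'n \<Rightarrow> complex) \<Rightarrow> (real ^ 'n \<Rightarrow> complex)" where
  "schroedinger_rep z \<tau> \<phi> = (\<lambda>y.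
     exp (2 * pi * \<i> * \<tau>) * exp (- (\<i> * pi * (position z \<bullet> momentum z))) *
     exp (2 * pi * \<i> * (momentum z \<bullet> y)) * \<phi> (y - position z))"

definition metaplectic ::
    "real ^ ('n::finite + 'n) ^ ('n + 'n) \<Rightarrow> ((real ^ 'n \<Rightarrow> complex) \<Rightarrow> (real ^ 'n \<Rightarrow> complex)) \<Rightarrow> bool" where
  "metaplectic S T \<longleftrightarrow> unitary_L2 T \<and>
     (\<forall>z \<tau>. \<forall>\<phi>\<in>L2.
        L2_eq (T (schroedinger_rep z \<tau> (L2_inverse T \<phi>))) (schroedinger_rep (S *v z) \<tau> \<phi>))"

end

(*
  Conjugating a modulation by T gives a translation combined with a modulation, and B being
  invertible means that all translations occur.  Testing |f|^2 against |m|^2, where m is an average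
  of modulations, therefore bounds the averages of |f|^2 over balls by ||T f||_1^2; hence
  |f| <= C ||T f||_1 almost everywhere.  Consequently an orthonormal family that is
  concentrated on E, and whose image under T is concentrated on F, has at most C' |E| |F| members.

  As in the argument of Amrein and Berthier, one concentrated function would produce too many:
  if phi is concentrated on E and T phi on F, then the products p(w) phi, with w a character
  of small frequency and p a polynomial of degree < N, are concentrated on E, and their images on
  a union of N small translates of F, of measure at most |F| + 1.  The family is orthonormalised
  with coefficients bounded in terms of N, E and F only, because the dispersive bound prevents the
  mass of phi from gathering near the zeros of p(w).  This makes the argument quantitative, so
  that no compactness of operators is needed.
*)
theory Submission
  imports Defs "HOL-Computational_Algebra.Fundamental_Theorem_Algebra"
begin

section \<open>Functions with bounded ball averages\<close>

text \<open>A free metaplectic operator is an integral operator whose kernel has constant modulus,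
  which would give the bound of |f| by ||T f||_1 at once. Here the operator is known only through
  its intertwining relation, so the bound is extracted from that relation; its constant is not
  sharp, but only its independence of f counts.

  Powers of one character w are used because T turns multiplication by w^j into a translation by j B
  theta, up to factors of modulus 1, and a small theta keeps the union of the N translates of F
  almost as small as F. The price is that the functions w^j phi can be nearly parallel, so that
  orthonormalising them takes large coefficients, and a bound on these is needed before phi is
  chosen. This dictates the order of the constants: N from the dispersive constant and the two
  measures, theta from N and F, then a lower bound for monic polynomials in w on most of E, then the
  coefficient bound, and last the permitted mass outside E and F.\<close>

lemma AE_le_of_ball_average:
  fixes p :: "'a::euclidean_space \<Rightarrow> real"
  assumes p [measurable]: "integrable lborel p" and p0: "\<And>x. 0 \<le> p x" and K0: "0 \<le> K"
    and avg: "\<And>x r. 0 < r \<Longrightarrow> (\<integral>\<^sup>+y. ennreal (p y) * indicator (ball x r) y \<partial>lborel) \<le> ennreal K * emeasure lborel (ball x r)"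
  shows "AE x in lborel. p x \<le> K"
proof -
  have pm [measurable]: "p \<in> borel_measurable borel"
    using p by auto
  define M where "M = density lborel (\<lambda>y. ennreal (p y))"
  have M_eq: "emeasure M A = (\<integral>\<^sup>+y. ennreal (p y) * indicator A y \<partial>lborel)" if "A \<in> sets borel" for A
    unfolding M_def using that by (subst emeasure_density) auto
  have sM [measurable_cong]: "sets M = sets borel" by (simp add: M_def)
  \<comment> \<open>A Vitali family of disjoint balls fills \<open>U\<close> up to a null set, so
    the bounds on balls add up to the same bound on \<open>U\<close>.\<close>
  have op: "emeasure M U \<le> ennreal K * emeasure lborel U" if U: "open U" for U
  proof -
    define I where "I = {i. 0 < snd i \<and> ball (fst i) (snd i) \<subseteq> U}"
    have *: "\<exists>i. i \<in> I \<and> x \<in> ball (fst i) (snd i) \<and> snd i < d" if "x \<in> U" "0 < d" for x d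
    proof -
      obtain e where e: "e > 0" "ball x e \<subseteq> U"
        using \<open>x \<in> U\<close> U open_contains_ball by blast
      have "ball x (min e (d/2)) \<subseteq> U" using e by auto
      then show ?thesis
        using e that by (intro exI[of _ "(x, min e (d/2))"]) (auto simp: I_def)
    qed
    obtain C where C: "countable C" "C \<subseteq> I"
       "pairwise (\<lambda>i j. disjnt (ball (fst i) (snd i)) (ball (fst j) (snd j))) C"
       "negligible (U - (\<Union>i \<in> C. ball (fst i) (snd i)))"
      by (rule Vitali_covering_theorem_balls[of U I fst snd]) (use * in auto)
    let ?B = "\<lambda>i. ball (fst i) (snd i)"
    have sub: "?B i \<subseteq> U" "0 < snd i" if "i \<in> C" for i
      using that C(2) unfolding I_def by blast+
    have dj: "disjoint_family_on ?B C"
      using C(3) by (auto simp: disjoint_family_on_def pairwise_def disjnt_def)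
    have opU: "open (\<Union>i\<in>C. ?B i)" by auto
    have "(U - (\<Union>i\<in>C. ?B i)) \<in> sets borel" using U opU by auto
    then have nul: "(U - (\<Union>i\<in>C. ?B i)) \<in> null_sets lborel"
      using C(4) unfolding negligible_iff_null_sets
      by (simp add: null_sets_completion_iff)
    \<comment> \<open>\<open>M\<close> has a density with respect to Lebesgue measure, so the
      remainder left by Vitali's theorem is null for \<open>M\<close> as well.\<close>
    then have "(U - (\<Union>i\<in>C. ?B i)) \<in> null_sets M"
      using absolutely_continuousI_density[of "\<lambda>y. ennreal (p y)" lborel]
      by (auto simp: absolutely_continuous_def M_def)
    moreover have "U = (\<Union>i\<in>C. ?B i) \<union> (U - (\<Union>i\<in>C. ?B i))"
      using sub(1) by blast
    moreover have "(\<Union>i\<in>C. ?B i) \<in> sets M" using opU by (simp add: sM)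
    ultimately have "emeasure M U = emeasure M (\<Union>i\<in>C. ?B i)"
      using emeasure_Un_null_set[of "\<Union>i\<in>C. ?B i" M "U - (\<Union>i\<in>C. ?B i)"] by simp
    also have "\<dots> = (\<integral>\<^sup>+i. emeasure M (?B i) \<partial>count_space C)"
      by (rule emeasure_UN_countable) (use C dj sM in auto)
    also have "\<dots> \<le> (\<integral>\<^sup>+i. ennreal K * emeasure lborel (?B i) \<partial>count_space C)"
      using sub(2) by (intro nn_integral_mono) (auto simp: M_eq intro!: avg)
    also have "\<dots> = ennreal K * emeasure lborel (\<Union>i\<in>C. ?B i)"
      by (subst emeasure_UN_countable) (use C dj in \<open>auto simp: nn_integral_cmult\<close>)
    also have "\<dots> \<le> ennreal K * emeasure lborel U"
      using sub(1) U by (intro mult_left_mono emeasure_mono UN_least) auto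
    finally show ?thesis .
  qed
  have bor: "emeasure M A \<le> ennreal K * emeasure lborel A" if A: "A \<in> sets borel" "emeasure lborel A < \<infinity>" for A
  proof (rule ennreal_le_epsilon)
    fix e :: real assume e: "0 < e"
    \<comment> \<open>All that matters is K * d <= e; dividing by K + 1 covers K = 0 too.\<close>
    define d where "d = e / (K + 1)"
    have d: "d > 0" using e K0 by (simp add: d_def)
    obtain U where U: "open U" "A \<subseteq> U" "emeasure lborel (U - A) < ennreal d"
      using outer_regular_lborel[OF A(1), of d] d by blast
    have "emeasure M A \<le> emeasure M U" using U sM by (intro emeasure_mono) auto
    also have "\<dots> \<le> ennreal K * emeasure lborel U" by (rule op[OF U(1)])
    also have "emeasure lborel U = emeasure lborel A + emeasure lborel (U - A)"
      using U A by (subst plus_emeasure) (auto intro!: arg_cong[where f="emeasure lborel"])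
    also have "ennreal K * \<dots> \<le> ennreal K * emeasure lborel A + ennreal K * ennreal d"
      unfolding distrib_left[symmetric] using U by (intro mult_left_mono add_left_mono) auto
    also have "ennreal K * ennreal d \<le> ennreal e"
      using K0 e by (simp add: ennreal_mult[symmetric] d_def field_simps)
    finally show "emeasure M A \<le> ennreal K * emeasure lborel A + ennreal e" by (simp add: add_left_mono)
  qed
  have "AE x in lborel. x \<in> ball 0 (real n) \<longrightarrow> p x \<le> K" for n
  proof -
    \<comment> \<open>If this set had positive measure, the integral of \<open>p\<close> over it
      would exceed \<open>K\<close> times that measure, against the bound for Borel sets. The ball
      keeps the measure finite, and balls of integer radius exhaust the space.\<close>
    define A where "A = {x \<in> ball 0 (real n). K < p x}"
    have A [measurable]: "A \<in> sets borel" unfolding A_def by measurable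
    have Afin: "emeasure lborel A < \<infinity>"
      by (rule le_less_trans[OF emeasure_mono emeasure_lborel_ball_finite[of 0 "real n"]]) (auto simp: A_def)
    have i1: "integrable lborel (\<lambda>x. indicator A x * p x)"
      using integrable_real_mult_indicator[OF _ p, of A] by (simp add: mult.commute)
    have i2: "integrable lborel (\<lambda>x. indicator A x * K)"
      using Afin by (intro integrable_mult_left) auto
    have "ennreal (\<integral>x. indicator A x * p x \<partial>lborel) = (\<integral>\<^sup>+x. ennreal (indicator A x * p x) \<partial>lborel)"
      using i1 p0 by (intro nn_integral_eq_integral[symmetric]) auto
    also have "\<dots> = emeasure M A"
      by (subst M_eq) (auto simp: indicator_def intro!: nn_integral_cong)
    also have "\<dots> \<le> ennreal K * emeasure lborel A" by (rule bor) (use Afin in auto)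
    also have "\<dots> = ennreal (K * measure lborel A)"
      using Afin K0 by (simp add: emeasure_eq_ennreal_measure ennreal_mult)
    finally have "(\<integral>x. indicator A x * p x \<partial>lborel) \<le> K * measure lborel A"
      using K0 by (subst (asm) ennreal_le_iff) auto
    then have le: "(\<integral>x. indicator A x * (p x - K) \<partial>lborel) \<le> 0"
      using i1 i2 by (simp add: right_diff_distrib mult.commute)
    have nn: "0 \<le> indicator A x * (p x - K)" for x by (auto simp: A_def indicator_def)
    have "(\<integral>x. indicator A x * (p x - K) \<partial>lborel) = 0"
      using le nn by (intro antisym integral_nonneg) auto
    then have "AE x in lborel. indicator A x * (p x - K) = 0"
      using i1 i2 nn by (subst (asm) integral_nonneg_eq_0_iff_AE) (auto simp: right_diff_distrib)
    then show ?thesis by eventually_elim (auto simp: A_def indicator_def split: if_splits)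
  qed
  then have "AE x in lborel. \<forall>n. x \<in> ball 0 (real n) \<longrightarrow> p x \<le> K"
    unfolding AE_all_countable by (rule allI)
  then show ?thesis
  proof eventually_elim
    case (elim x)
    obtain n where "norm x < real n" using reals_Archimedean2 by blast
    then show ?case using elim by auto
  qed
qed

section \<open>Ball averages bounded through an autocorrelation\<close>

lemma borel_measurable_cnj [measurable]: "cnj \<in> borel_measurable borel"
  by (intro borel_measurable_continuous_onI continuous_intros)

text \<open>Squaring the modulus doubles the average over \<open>M\<close>, and Fubini moves the
  integral over \<open>N\<close> to the inside. For characters \<open>e s y\<close> the innermost
  integral is, up to a factor of modulus 1, a Fourier coefficient of \<open>N\<close> that depends
  on the difference of \<open>s\<close> and \<open>t\<close>, and this can be estimated. Finite
  measures and the bound 1 give integrability at each exchange.\<close>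

lemma fubini_square:
  fixes e :: "'a \<Rightarrow> 'b \<Rightarrow> complex"
  assumes "finite_measure M" "finite_measure N"
    and [measurable]: "(\<lambda>(s, y). e s y) \<in> borel_measurable (M \<Otimes>\<^sub>M N)"
    and bd: "\<And>s y. norm (e s y) \<le> 1"
  shows "complex_of_real (\<integral>y. (norm (\<integral>s. e s y \<partial>M))\<^sup>2 \<partial>N) = (\<integral>s. \<integral>t. \<integral>y. e s y * cnj (e t y) \<partial>N \<partial>M \<partial>M)"
proof -
  interpret M: finite_measure M by fact
  interpret N: finite_measure N by fact
  interpret MN: pair_sigma_finite M N ..
  interpret MN': finite_measure "M \<Otimes>\<^sub>M N" by (rule finite_measure_pair_measure) unfold_locales
  interpret MM: pair_sigma_finite M M ..
  have le1: "norm (e s y * cnj (e t y)) \<le> 1" for s t y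
    using mult_mono[OF bd[of s y] bd[of t y]] by (simp add: norm_mult)
  define g where "g s y = e s y * (\<integral>t. cnj (e t y) \<partial>M)" for s y
  have gm [measurable]: "(\<lambda>(s, y). g s y) \<in> borel_measurable (M \<Otimes>\<^sub>M N)"
    unfolding g_def by measurable
  have eb: "norm (\<integral>t. cnj (e t y) \<partial>M) \<le> measure M (space M)" for y
  proof -
    have "norm (\<integral>t. cnj (e t y) \<partial>M) \<le> (\<integral>t. norm (cnj (e t y)) \<partial>M)" by simp
    also have "\<dots> \<le> (\<integral>t. 1 \<partial>M)" by (rule integral_mono') (auto simp: bd)
    finally show ?thesis by simp
  qed
  have gi: "integrable (M \<Otimes>\<^sub>M N) (\<lambda>(s, y). g s y)"
  proof (rule MN'.integrable_const_bound[where B="measure M (space M)"])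
    show "AE x in M \<Otimes>\<^sub>M N. norm (case x of (s, y) \<Rightarrow> g s y) \<le> measure M (space M)"
      using mult_mono[OF bd eb] by (auto simp: g_def norm_mult)
  qed auto
  have ei: "integrable M (\<lambda>s. e s y)" if "y \<in> space N" for y
    by (rule M.integrable_const_bound[where B=1]) (use bd that in auto)
  have "complex_of_real (\<integral>y. (norm (\<integral>s. e s y \<partial>M))\<^sup>2 \<partial>N) = (\<integral>y. complex_of_real ((norm (\<integral>s. e s y \<partial>M))\<^sup>2) \<partial>N)"
    by (simp only: integral_complex_of_real)
  also have "\<dots> = (\<integral>y. \<integral>s. g s y \<partial>M \<partial>N)"
    by (intro Bochner_Integration.integral_cong refl)
       (simp only: g_def complex_norm_square integral_mult_left_zero Bochner_Integration.integral_cnj)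
  also have "\<dots> = (\<integral>s. \<integral>y. g s y \<partial>N \<partial>M)"
    by (rule MN.Fubini_integral[OF gi])
  also have "\<dots> = (\<integral>s. \<integral>t. \<integral>y. e s y * cnj (e t y) \<partial>N \<partial>M \<partial>M)"
  proof (rule Bochner_Integration.integral_cong[OF refl])
    fix s assume [measurable]: "s \<in> space M"
    have "(\<integral>y. g s y \<partial>N) = (\<integral>y. \<integral>t. e s y * cnj (e t y) \<partial>M \<partial>N)"
      by (simp add: g_def)
    also have "\<dots> = (\<integral>t. \<integral>y. e s y * cnj (e t y) \<partial>N \<partial>M)"
      by (rule MN.Fubini_integral, rule MN'.integrable_const_bound[where B=1]) (use le1 in auto)
    finally show "(\<integral>y. g s y \<partial>N) = (\<integral>t. \<integral>y. e s y * cnj (e t y) \<partial>N \<partial>M)" .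
  qed
  finally show ?thesis .
qed

lemma ennreal_norm_integral_le:
  fixes f :: "'a \<Rightarrow> 'b::{banach, second_countable_topology}"
  shows "ennreal (norm (integral\<^sup>L M f)) \<le> (\<integral>\<^sup>+x. ennreal (norm (f x)) \<partial>M)"
  by (cases "integrable M f") (auto simp: integral_norm_bound_ennreal not_integrable_integral_eq)

text \<open>In the application \<open>p\<close> is |f|^2, \<open>q\<close> is |T f| and
  \<open>L\<close> inverts the block B; \<open>hyp\<close> bounds the Fourier transform of
  \<open>p\<close> by the autocorrelation of \<open>q\<close>. An average of characters whose
  frequencies fill the image of a ball of radius about 1/r stays large on a ball of radius
  \<open>r\<close>, while its square, tested against \<open>p\<close>, sees only that
  autocorrelation. The volume of the frequency ball is proportional to 1/r^n, with n the dimension,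
  so the bound scales like the volume of the ball in space and the factor in front does not depend
  on \<open>r\<close>.\<close>

lemma ball_average_bound:
  fixes p q :: "'a::euclidean_space \<Rightarrow> real" and L :: "'a \<Rightarrow> 'a"
  assumes p: "integrable lborel p" and p0: "\<And>x. 0 \<le> p x"
    and q: "integrable lborel q" and q0: "\<And>x. 0 \<le> q x"
    and L: "linear L" and kappa: "\<And>t. norm (L t) \<le> \<kappa> * norm t" "0 < \<kappa>"
    and hyp: "\<And>t. ennreal (norm (\<integral>y. cis (2 * pi * (L t \<bullet> y)) * of_real (p y) \<partial>lborel))
                 \<le> (\<integral>\<^sup>+w. ennreal (q (w - t)) * ennreal (q w) \<partial>lborel)"
    and r: "0 < r"
  shows "(\<integral>\<^sup>+y. ennreal (p y) * indicator (ball y0 r) y \<partial>lborel)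
    \<le> ennreal (4 * (6 * \<kappa>) ^ DIM('a) / (measure lborel (ball (0::'a) 1))\<^sup>2 * (\<integral>x. q x \<partial>lborel)\<^sup>2) * emeasure lborel (ball y0 r)"
proof -
  have pm [measurable]: "p \<in> borel_measurable borel" and qm [measurable]: "q \<in> borel_measurable borel"
    using p q by auto
  have Lm [measurable]: "L \<in> borel_measurable borel"
    using L by (intro borel_measurable_continuous_onI linear_continuous_on linear_conv_bounded_linear[THEN iffD1])
  \<comment> \<open>For \<open>s\<close> in the ball of radius \<open>R\<close> and \<open>y\<close>
    in \<open>ball y0 r\<close> the phase is at most 2 * pi * \<kappa> * R * r = pi/3 in modulus, so
    each character has real part at least 1/2.\<close>
  define R where "R = 1 / (6 * \<kappa> * r)"
  have R: "R > 0" using r kappa by (simp add: R_def)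
  define Q where "Q = ball (0::'a) R"
  have Qm [measurable]: "Q \<in> sets borel" by (simp add: Q_def)
  define V where "V = measure lborel Q"
  have Qfin: "emeasure lborel Q < \<infinity>" unfolding Q_def by (rule emeasure_lborel_ball_finite)
  then have eQ: "emeasure lborel Q = ennreal V" by (simp add: V_def emeasure_eq_ennreal_measure)
  have V: "V > 0" unfolding V_def Q_def by (rule content_ball_pos[OF R])
  define M where "M = density lborel (indicator Q :: 'a \<Rightarrow> ennreal)"
  define N where "N = density lborel (\<lambda>y. ennreal (p y))"
  have sM [measurable_cong]: "sets M = sets borel" and sN [measurable_cong]: "sets N = sets borel"
    by (simp_all add: M_def N_def)
  have spM: "space M = UNIV" and spN: "space N = UNIV" by (simp_all add: M_def N_def)
  have fM: "finite_measure M"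
    by (rule finite_measureI) (use Qfin in \<open>auto simp: M_def emeasure_density\<close>)
  have fN: "finite_measure N"
  proof (rule finite_measureI)
    have "emeasure N (space N) = (\<integral>\<^sup>+y. ennreal (p y) \<partial>lborel)"
      by (simp add: N_def emeasure_density)
    then show "emeasure N (space N) \<noteq> \<infinity>"
      using p p0 by (simp add: nn_integral_eq_integral)
  qed
  \<comment> \<open>Centring at \<open>y0\<close> makes the phases small on the ball in question. In
    the products e s y * cnj (e t y) the centre leaves only a factor of modulus 1 that does not
    depend on \<open>y\<close>.\<close>
  define e where "e s y = cis (2 * pi * (L s \<bullet> (y - y0)))" for s y
  have cism [measurable]: "cis \<in> borel_measurable borel"
    by (intro borel_measurable_continuous_onI continuous_intros)
  have em: "(\<lambda>(s, y). e s y) \<in> borel_measurable (M \<Otimes>\<^sub>M N)"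
    unfolding e_def by measurable
  have em1 [measurable]: "(\<lambda>s. e s y) \<in> borel_measurable borel" for y
    unfolding e_def by measurable
  have em2 [measurable]: "(\<lambda>y. e s y) \<in> borel_measurable borel" for s
    unfolding e_def by measurable
  define m where "m y = (\<integral>s. e s y \<partial>M)" for y
  have mm [measurable]: "m \<in> borel_measurable borel"
  proof -
    interpret M: finite_measure M by (rule fM)
    have "(\<lambda>(y, s). e s y) \<in> borel_measurable (borel \<Otimes>\<^sub>M M)"
      unfolding e_def by measurable
    then show ?thesis unfolding m_def by measurable
  qed
  have m_lower: "V / 2 \<le> norm (m y)" if y: "y \<in> ball y0 r" for y
  proof -
    have i: "integrable lborel (\<lambda>s. indicator Q s *\<^sub>R e s y)"
      by (rule integrableI_bounded_set_indicator[where B=1]) (use Qfin in \<open>auto simp: e_def\<close>)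
    have "m y = (\<integral>s. indicator Q s *\<^sub>R e s y \<partial>lborel)"
      unfolding m_def M_def
      by (subst integral_density[symmetric, of _ _ "\<lambda>x. indicator Q x"])
         (auto simp: ennreal_indicator)
    then have "Re (m y) = (\<integral>s. Re (indicator Q s *\<^sub>R e s y) \<partial>lborel)"
      by (simp only: integral_Re[OF i])
    also have "\<dots> \<ge> (\<integral>s. indicator Q s * (1/2) \<partial>lborel)"
    proof (rule integral_mono)
      fix s
      show "indicator Q s * (1/2) \<le> Re (indicator Q s *\<^sub>R e s y)"
      proof (cases "s \<in> Q")
        case True
        have "\<bar>L s \<bullet> (y - y0)\<bar> \<le> norm (L s) * norm (y - y0)" by (rule Cauchy_Schwarz_ineq2)
        also have "\<dots> \<le> (\<kappa> * R) * r"
        proof (rule mult_mono)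
          have "\<kappa> * norm s \<le> \<kappa> * R" using True kappa(2) by (simp add: Q_def)
          then show "norm (L s) \<le> \<kappa> * R" using kappa(1)[of s] by linarith
          show "norm (y - y0) \<le> r" using y by (simp add: dist_norm norm_minus_commute)
        qed (use kappa(2) R in auto)
        also have "\<dots> = 1/6" using r kappa by (simp add: R_def field_simps)
        finally have "\<bar>2 * pi * (L s \<bullet> (y - y0))\<bar> \<le> pi / 3"
          by (simp add: abs_mult)
        then have "cos (pi/3) \<le> cos \<bar>2 * pi * (L s \<bullet> (y - y0))\<bar>"
          by (rule cos_monotone_0_pi_le[OF abs_ge_zero]) simp
        then show ?thesis using True by (simp add: e_def cos_60)
      qed auto
    next
      show "integrable lborel (\<lambda>s. indicator Q s * (1/2 :: real))"
        using Qfin by (intro integrable_mult_left) auto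
      show "integrable lborel (\<lambda>s. Re (indicator Q s *\<^sub>R e s y))"
        by (rule integrable_Re[OF i])
    qed
    finally have "V / 2 \<le> Re (m y)" by (simp add: V_def)
    then show ?thesis using complex_Re_le_cmod order_trans by blast
  qed
  \<comment> \<open>This trivial bound serves the integrability of |m|^2 with respect to
    \<open>N\<close>.\<close>
  have m_upper: "norm (m y) \<le> V" for y
  proof -
    have "norm (m y) \<le> (\<integral>s. norm (e s y) \<partial>M)" unfolding m_def by simp
    also have "\<dots> = measure M (space M)" by (simp add: e_def)
    also have "\<dots> = V" unfolding M_def V_def measure_def by (simp add: emeasure_density)
    finally show ?thesis .
  qed
  define I where "I = (\<integral>y. (norm (m y))\<^sup>2 \<partial>N)"
  have "0 \<le> I" by (simp add: I_def)
  have H: "ennreal (norm (\<integral>y. e s y * cnj (e t y) \<partial>N)) \<le> (\<integral>\<^sup>+w. ennreal (q (w - (s - t))) * ennreal (q w) \<partial>lborel)" for s t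
  proof -
    have ee: "e s y * cnj (e t y) = cis (- (2 * pi * (L (s - t) \<bullet> y0))) * cis (2 * pi * (L (s - t) \<bullet> y))" for y
      unfolding e_def linear_diff[OF L] cis_cnj cis_mult
      by (rule arg_cong[where f=cis]) (simp add: algebra_simps inner_diff_left inner_diff_right)
    have "(\<integral>y. e s y * cnj (e t y) \<partial>N) = (\<integral>y. p y *\<^sub>R (cis (- (2 * pi * (L (s - t) \<bullet> y0))) * cis (2 * pi * (L (s - t) \<bullet> y))) \<partial>lborel)"
      unfolding ee N_def by (rule integral_density) (auto simp: p0)
    also have "\<dots> = cis (- (2 * pi * (L (s - t) \<bullet> y0))) * (\<integral>y. cis (2 * pi * (L (s - t) \<bullet> y)) * of_real (p y) \<partial>lborel)"
      by (subst integral_mult_right_zero[symmetric]) (simp add: scaleR_conv_of_real mult_ac)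
    finally show ?thesis using hyp[of "s - t"] by (simp add: norm_mult)
  qed
  define J where "J = (\<integral>x. q x \<partial>lborel)"
  have J: "(\<integral>\<^sup>+x. ennreal (q x) \<partial>lborel) = ennreal J" "0 \<le> J"
    using q q0 by (auto simp: J_def nn_integral_eq_integral)
  \<comment> \<open>Only the average over \<open>s\<close> keeps its restriction to \<open>Q\<close>
    and contributes a factor \<open>V\<close>. The one over \<open>t\<close> is extended to the
    whole space, where translation invariance splits the double integral into J * J. Against the
    lower bound V^2 / 4 for |m|^2 this leaves 4 * J^2 / V.\<close>
  have inner: "(\<integral>\<^sup>+t. (\<integral>\<^sup>+w. ennreal (q (w - (s - t))) * ennreal (q w) \<partial>lborel) \<partial>M) \<le> ennreal (J\<^sup>2)" for s
  proof -
    have "(\<integral>\<^sup>+t. (\<integral>\<^sup>+w. ennreal (q (w - (s - t))) * ennreal (q w) \<partial>lborel) \<partial>M)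
      = (\<integral>\<^sup>+t. indicator Q t * (\<integral>\<^sup>+w. ennreal (q (w - (s - t))) * ennreal (q w) \<partial>lborel) \<partial>lborel)"
      unfolding M_def by (rule nn_integral_density) auto
    also have "\<dots> \<le> (\<integral>\<^sup>+t. (\<integral>\<^sup>+w. ennreal (q (w - (s - t))) * ennreal (q w) \<partial>lborel) \<partial>lborel)"
      by (intro nn_integral_mono) (auto simp: indicator_def)
    also have "\<dots> = (\<integral>\<^sup>+w. (\<integral>\<^sup>+t. ennreal (q (w - (s - t))) * ennreal (q w) \<partial>lborel) \<partial>lborel)"
      by (rule lborel_pair.Fubini') measurable
    also have "\<dots> = (\<integral>\<^sup>+w. ennreal J * ennreal (q w) \<partial>lborel)"
    proof (rule nn_integral_cong)
      fix w
      have "(\<integral>\<^sup>+t. ennreal (q (w - (s - t))) \<partial>lborel) = (\<integral>\<^sup>+t. ennreal (q ((w - s) + t)) \<partial>lborel)"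
        by (simp add: algebra_simps)
      also have "\<dots> = (\<integral>\<^sup>+x. ennreal (q x) \<partial>distr lborel borel ((+) (w - s)))"
        by (subst nn_integral_distr) auto
      also have "\<dots> = ennreal J" by (simp add: lborel_distr_plus J)
      finally show "(\<integral>\<^sup>+t. ennreal (q (w - (s - t))) * ennreal (q w) \<partial>lborel) = ennreal J * ennreal (q w)"
        by (simp add: nn_integral_multc)
    qed
    also have "\<dots> = ennreal (J\<^sup>2)"
      using J by (simp add: nn_integral_cmult ennreal_mult power2_eq_square)
    finally show ?thesis .
  qed
  have "ennreal I = ennreal (norm (complex_of_real I))" using \<open>0 \<le> I\<close> by simp
  also have "complex_of_real I = (\<integral>s. \<integral>t. \<integral>y. e s y * cnj (e t y) \<partial>N \<partial>M \<partial>M)"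
    unfolding I_def m_def by (rule fubini_square[OF fM fN em]) (simp add: e_def)
  also have "ennreal (norm \<dots>) \<le> (\<integral>\<^sup>+s. ennreal (norm (\<integral>t. \<integral>y. e s y * cnj (e t y) \<partial>N \<partial>M)) \<partial>M)"
    by (rule ennreal_norm_integral_le)
  also have "\<dots> \<le> (\<integral>\<^sup>+s. (\<integral>\<^sup>+t. ennreal (norm (\<integral>y. e s y * cnj (e t y) \<partial>N)) \<partial>M) \<partial>M)"
    by (intro nn_integral_mono ennreal_norm_integral_le)
  also have "\<dots> \<le> (\<integral>\<^sup>+s. ennreal (J\<^sup>2) \<partial>M)"
    by (intro nn_integral_mono order_trans[OF nn_integral_mono[OF H] inner])
  also have "\<dots> = ennreal (J\<^sup>2 * V)"
    using eQ V by (simp add: M_def emeasure_density ennreal_mult)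
  finally have IJ: "I \<le> J\<^sup>2 * V" using V by (subst (asm) ennreal_le_iff) auto
  have [measurable]: "ball y0 r \<in> sets borel" by simp
  have "ennreal (V\<^sup>2 / 4) * (\<integral>\<^sup>+y. ennreal (p y) * indicator (ball y0 r) y \<partial>lborel)
      = (\<integral>\<^sup>+y. ennreal (p y) * (ennreal (V\<^sup>2 / 4) * indicator (ball y0 r) y) \<partial>lborel)"
    by (subst nn_integral_cmult[symmetric]) (measurable, simp add: mult_ac)
  also have "\<dots> \<le> (\<integral>\<^sup>+y. ennreal (p y) * ennreal ((norm (m y))\<^sup>2) \<partial>lborel)"
  proof (intro nn_integral_mono mult_left_mono)
    fix y
    show "ennreal (V\<^sup>2 / 4) * indicator (ball y0 r) y \<le> ennreal ((norm (m y))\<^sup>2)"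
      using power_mono[OF m_lower[of y], of 2] V
      by (auto simp: indicator_def power_divide)
  qed simp
  also have "\<dots> = (\<integral>\<^sup>+y. ennreal ((norm (m y))\<^sup>2) \<partial>N)"
    unfolding N_def by (rule nn_integral_density[symmetric]) auto
  also have "\<dots> = ennreal I"
  proof -
    interpret N: finite_measure N by (rule fN)
    have "integrable N (\<lambda>y. (norm (m y))\<^sup>2)"
      by (rule N.integrable_const_bound[where B="V\<^sup>2"]) (auto intro!: power_mono m_upper)
    then show ?thesis unfolding I_def by (intro nn_integral_eq_integral) auto
  qed
  also have "\<dots> \<le> ennreal (J\<^sup>2 * V)" using IJ by (rule ennreal_leI)
  finally have main: "ennreal (V\<^sup>2 / 4) * (\<integral>\<^sup>+y. ennreal (p y) * indicator (ball y0 r) y \<partial>lborel) \<le> ennreal (J\<^sup>2 * V)" .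
  define X where "X = (\<integral>\<^sup>+y. ennreal (p y) * indicator (ball y0 r) y \<partial>lborel)"
  define \<omega> where "\<omega> = measure lborel (ball (0::'a) 1)"
  have \<omega>: "\<omega> > 0" unfolding \<omega>_def by (rule content_ball_pos) simp
  have VR: "V = R ^ DIM('a) * \<omega>"
    unfolding V_def Q_def \<omega>_def using R by (subst content_ball_conv_unit_ball) auto
  have b: "emeasure lborel (ball y0 r) = ennreal (r ^ DIM('a) * \<omega>)"
    using content_ball_conv_unit_ball[of r y0] r emeasure_lborel_ball_finite[of y0 r]
    by (simp add: emeasure_eq_ennreal_measure \<omega>_def)
  have Rr: "R ^ DIM('a) * (6 * \<kappa>) ^ DIM('a) * r ^ DIM('a) = 1"
    unfolding power_mult_distrib[symmetric] using r kappa by (simp add: R_def)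
  \<comment> \<open>V = R^n * \<omega> and R^n * (6 * \<kappa> * r)^n = 1, so 1 / V is a constant
    multiple of r^n * \<omega>, the volume of \<open>ball y0 r\<close>.\<close>
  have "4 * J\<^sup>2 / V = 4 * (6 * \<kappa>) ^ DIM('a) / \<omega>\<^sup>2 * J\<^sup>2 * (r ^ DIM('a) * \<omega>)"
  proof -
    have gen: "4 * a / x\<^sup>2 * j * (b * x) = 4 * j / (c * x)"
      if "c * a * b = 1" "x > 0" "c > 0" for a b c j x :: real
    proof -
      have "4 * a / x\<^sup>2 * j * (b * x) * (c * x) = 4 * j * (c * a * b)"
        using that(2) by (simp add: power2_eq_square)
      then have "4 * a / x\<^sup>2 * j * (b * x) * (c * x) = 4 * j" unfolding that(1) by simp
      then show ?thesis using that(2,3) by (subst eq_divide_eq) simp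
    qed
    show ?thesis unfolding VR by (rule gen[symmetric]) (use Rr \<omega> R in auto)
  qed
  moreover have "X \<le> ennreal (4 * J\<^sup>2 / V)"
  proof -
    have "X = ennreal (4 / V\<^sup>2) * (ennreal (V\<^sup>2 / 4) * X)"
      using V by (simp add: mult.assoc[symmetric] ennreal_mult[symmetric])
    also have "\<dots> \<le> ennreal (4 / V\<^sup>2) * ennreal (J\<^sup>2 * V)"
      using main unfolding X_def by (rule mult_left_mono) simp
    also have "\<dots> = ennreal (4 * J\<^sup>2 / V)"
      using V by (simp add: ennreal_mult[symmetric] power2_eq_square)
    finally show ?thesis .
  qed
  ultimately show ?thesis
    unfolding X_def[symmetric] b J_def[symmetric] \<omega>_def[symmetric]
    using \<omega> r kappa by (simp add: ennreal_mult[symmetric])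
qed

section \<open>Orthonormal families\<close>

text \<open>At a fixed point the coefficients a k = cnj (v k x) turn the hypothesis into X^2 <= K *
  X for the sum X of squares. These coefficients vary with \<open>x\<close>, however, while the
  exceptional null set varies with \<open>a\<close>. Coefficients from a countable dense set share
  one null set, and a limit at the given point recovers the optimal ones.\<close>

lemma AE_sum_norm_square_le:
  fixes v :: "nat \<Rightarrow> 'a \<Rightarrow> complex"
  assumes bd: "\<And>a. AE x in M. (norm (\<Sum>k<N. a k * v k x))\<^sup>2 \<le> K * (\<Sum>k<N. (norm (a k))\<^sup>2)"
    and K: "0 \<le> K"
  shows "AE x in M. (\<Sum>k<N. (norm (v k x))\<^sup>2) \<le> K"
proof -
  obtain D :: "complex set" where D: "countable D" "\<And>X. open X \<Longrightarrow> X \<noteq> {} \<Longrightarrow> \<exists>d\<in>D. d \<in> X"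
    using countable_dense_exists by blast
  define A where "A = PiE {..<N} (\<lambda>_. D)"
  have "countable A" unfolding A_def using D(1) by (intro countable_PiE) auto
  then have "AE x in M. \<forall>a\<in>A. (norm (\<Sum>k<N. a k * v k x))\<^sup>2 \<le> K * (\<Sum>k<N. (norm (a k))\<^sup>2)"
    using bd by (simp add: AE_ball_countable)
  then show ?thesis
  proof eventually_elim
    case (elim x)
    have "\<exists>d\<in>D. dist d (cnj (v k x)) < 1 / Suc n" for n k
      using D(2)[of "ball (cnj (v k x)) (1 / Suc n)"] by (auto simp: dist_commute)
    then obtain d where d: "d n k \<in> D" "dist (d n k) (cnj (v k x)) < 1 / Suc n" for n k
    proof -
      have "\<forall>n k. \<exists>e. e \<in> D \<and> dist e (cnj (v k x)) < 1 / Suc n"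
        using \<open>\<And>n k. \<exists>d\<in>D. dist d (cnj (v k x)) < 1 / Suc n\<close> by blast
      then obtain d where "\<forall>n k. d n k \<in> D \<and> dist (d n k) (cnj (v k x)) < 1 / Suc n"
        unfolding choice_iff by blast
      then show thesis using that by blast
    qed
    have lim: "(\<lambda>n. d n k) \<longlonglongrightarrow> cnj (v k x)" for k
    proof (rule metric_tendsto_imp_tendsto[OF LIMSEQ_Suc[OF lim_1_over_n]])
      have "dist (d n k) (cnj (v k x)) \<le> dist (1 / real (Suc n)) 0" for n
        using less_imp_le[OF d(2)[of n k]] by simp
      then show "\<forall>\<^sub>F n in sequentially. dist (d n k) (cnj (v k x)) \<le> dist (1 / real (Suc n)) 0"
        by (intro always_eventually allI)
    qed
    have le: "(norm (\<Sum>k<N. d n k * v k x))\<^sup>2 \<le> K * (\<Sum>k<N. (norm (d n k))\<^sup>2)" for n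
      using bspec[OF elim, of "restrict (d n) {..<N}"] d(1) by (auto simp: A_def)
    have "(norm (\<Sum>k<N. cnj (v k x) * v k x))\<^sup>2 \<le> K * (\<Sum>k<N. (norm (cnj (v k x)))\<^sup>2)"
    proof (rule LIMSEQ_le)
      show "(\<lambda>n. (norm (\<Sum>k<N. d n k * v k x))\<^sup>2) \<longlonglongrightarrow> (norm (\<Sum>k<N. cnj (v k x) * v k x))\<^sup>2"
        by (intro tendsto_intros lim)
      show "(\<lambda>n. K * (\<Sum>k<N. (norm (d n k))\<^sup>2)) \<longlonglongrightarrow> K * (\<Sum>k<N. (norm (cnj (v k x)))\<^sup>2)"
        by (intro tendsto_intros lim)
    qed (use le in blast)
    moreover have "(\<Sum>k<N. cnj (v k x) * v k x) = complex_of_real (\<Sum>k<N. (norm (v k x))\<^sup>2)"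
      by (simp add: complex_norm_square mult.commute del: of_real_power)
    ultimately have "(\<Sum>k<N. (norm (v k x))\<^sup>2)\<^sup>2 \<le> K * (\<Sum>k<N. (norm (v k x))\<^sup>2)"
      by (simp only: norm_of_real power2_abs complex_mod_cnj)
    moreover have "0 \<le> (\<Sum>k<N. (norm (v k x))\<^sup>2)" by (intro sum_nonneg) auto
    ultimately show ?case using K
      by (cases "(\<Sum>k<N. (norm (v k x))\<^sup>2) = 0") (auto simp: power2_eq_square)
  qed
qed

text \<open>Gram-Schmidt for the monomials, with the order of quantifiers as the point:
  \<open>K\<close> depends on \<eta> and \<open>N\<close> alone and serves every form
  \<open>B\<close>, because \<open>B\<close> will be built from an arbitrary concentrated function.
  The lower bound on monic polynomials keeps each monomial away from the span of the lower ones, so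
  no normalising factor is large.\<close>

lemma gram_schmidt_poly:
  fixes \<eta> :: real
  assumes \<eta>: "0 < \<eta>"
  shows "\<exists>K>0. \<forall>B :: complex poly \<Rightarrow> complex poly \<Rightarrow> complex.
    (\<forall>p q r c. B (smult c p + q) r = c * B p r + B q r) \<longrightarrow> (\<forall>p q. B q p = cnj (B p q)) \<longrightarrow>
    (\<forall>k. B (monom 1 k) (monom 1 k) = 1) \<longrightarrow>
    (\<forall>Q. lead_coeff Q = 1 \<and> degree Q < N \<longrightarrow> \<eta> \<le> Re (B Q Q)) \<longrightarrow>
    (\<exists>P. \<forall>k<N. degree (P k) \<le> k \<and> (\<forall>j. norm (coeff (P k) j) \<le> K) \<and>
        (\<forall>i<N. B (P k) (P i) = (if k = i then 1 else 0)))"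
proof (induction N)
  case 0
  show ?case
    by (intro exI[of _ "1::real"] conjI zero_less_one allI impI exI) (erule less_zeroE)+
next
  case (Suc N)
  obtain K where K: "K > 0" and IH: "\<forall>B :: complex poly \<Rightarrow> complex poly \<Rightarrow> complex.
    (\<forall>p q r c. B (smult c p + q) r = c * B p r + B q r) \<longrightarrow> (\<forall>p q. B q p = cnj (B p q)) \<longrightarrow>
    (\<forall>k. B (monom 1 k) (monom 1 k) = 1) \<longrightarrow>
    (\<forall>Q. lead_coeff Q = 1 \<and> degree Q < N \<longrightarrow> \<eta> \<le> Re (B Q Q)) \<longrightarrow>
    (\<exists>P. \<forall>k<N. degree (P k) \<le> k \<and> (\<forall>j. norm (coeff (P k) j) \<le> K) \<and>
        (\<forall>i<N. B (P k) (P i) = (if k = i then 1 else 0)))"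
    using Suc.IH by (elim exE conjE)
  \<comment> \<open>The projections onto the \<open>N\<close> earlier members have modulus at most
    1, so the new monic polynomial has coefficients at most 1 + N * K before it is normalised.
    Normalising divides by at least the square root of \<eta>.\<close>
  define K' where "K' = max K ((1 + N * K) / sqrt \<eta>)"
  show ?case
  proof (intro exI[of _ K'] conjI allI impI)
    show "0 < K'" using K by (simp add: K'_def)
    fix B :: "complex poly \<Rightarrow> complex poly \<Rightarrow> complex"
    assume lin: "\<forall>p q r c. B (smult c p + q) r = c * B p r + B q r"
      and herm: "\<forall>p q. B q p = cnj (B p q)"
      and unit: "\<forall>k. B (monom 1 k) (monom 1 k) = 1"
      and pos: "\<forall>Q. lead_coeff Q = 1 \<and> degree Q < Suc N \<longrightarrow> \<eta> \<le> Re (B Q Q)"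
    obtain P where P: "\<And>k. k < N \<Longrightarrow> degree (P k) \<le> k"
      "\<And>k j. k < N \<Longrightarrow> norm (coeff (P k) j) \<le> K"
      "\<And>k i. k < N \<Longrightarrow> i < N \<Longrightarrow> B (P k) (P i) = (if k = i then 1 else 0)"
    proof -
      have "\<forall>Q. lead_coeff Q = 1 \<and> degree Q < N \<longrightarrow> \<eta> \<le> Re (B Q Q)"
        using pos less_SucI by blast
      from IH[THEN spec[of _ B], THEN mp, OF lin, THEN mp, OF herm, THEN mp, OF unit, THEN mp, OF this] obtain P where "\<forall>k<N. degree (P k) \<le> k \<and> (\<forall>j. norm (coeff (P k) j) \<le> K) \<and>
        (\<forall>i<N. B (P k) (P i) = (if k = i then 1 else 0))" ..
      then show thesis by (intro that[of P]) auto
    qed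
    have B0: "B 0 r = 0" for r using lin[rule_format, of 1 0 0 r] by simp
    have Bs: "B (smult c p) r = c * B p r" for c p r using lin[rule_format, of c p 0 r] B0 by simp
    have Bd: "B (p - q) r = B p r - B q r" for p q r
      using lin[rule_format, of "-1" q p r] by simp
    have Ba: "B (p + q) r = B p r + B q r" for p q r
      using lin[rule_format, of 1 p q r] by simp
    have Bsum: "B (\<Sum>i\<in>I. g i) r = (\<Sum>i\<in>I. B (g i) r)" for I :: "nat set" and g r
      by (induction I rule: infinite_finite_induct) (auto simp: B0 Ba)
    define x where "x = monom (1::complex) N"
    define c where "c i = B x (P i)" for i
    define Q where "Q = x - (\<Sum>i<N. smult (c i) (P i))"
    have cQ: "coeff Q j = coeff x j - (\<Sum>i<N. c i * coeff (P i) j)" for j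
      by (simp add: Q_def coeff_sum)
    have cP0: "coeff (P i) j = 0" if "i < N" "N \<le> j" for i j
      using P(1)[OF that(1)] that by (intro coeff_eq_0) auto
    have cQN: "coeff Q N = 1" by (simp add: cQ x_def cP0)
    have dQ: "degree Q = N"
    proof (rule antisym)
      show "degree Q \<le> N" by (rule degree_le) (auto simp: cQ x_def cP0)
      show "N \<le> degree Q" using cQN by (intro le_degree) auto
    qed
    have BQP: "B Q (P j) = 0" if "j < N" for j
    proof -
      have "B Q (P j) = c j - (\<Sum>i<N. c i * (if i = j then 1 else 0))"
        unfolding Q_def Bd Bsum Bs using that by (auto simp: c_def P(3) intro!: sum.cong)
      also have "\<dots> = 0" using that by (simp add: if_distrib cong: if_cong)
      finally show ?thesis .
    qed
    have BPQ: "B (P j) Q = 0" if "j < N" for j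
    proof -
      have "B (P j) Q = cnj (B Q (P j))" by (rule herm[rule_format])
      then show ?thesis by (simp only: BQP[OF that] complex_cnj_zero)
    qed
    have Px: "B (P i) x = cnj (c i)" for i
      unfolding c_def by (rule herm[rule_format])
    have "B Q Q = B x Q - (\<Sum>i<N. c i * B (P i) Q)"
      by (subst (1) Q_def) (simp add: Bd Bsum Bs)
    also have "\<dots> = B x Q" by (simp add: BPQ)
    also have "\<dots> = cnj (B Q x)" using herm by blast
    also have "B Q x = B x x - (\<Sum>i<N. c i * cnj (c i))"
      unfolding Q_def Bd Bsum Bs by (simp add: Px)
    also have "B x x = 1" using unit by (simp add: x_def)
    finally have BQQ: "B Q Q = complex_of_real (1 - (\<Sum>i<N. (norm (c i))\<^sup>2))"
      by (simp add: complex_norm_square mult.commute del: of_real_power)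
    \<comment> \<open>\<open>b\<close> is the squared length of the monic polynomial
      \<open>Q\<close>, hence at least \<eta>. As \<eta> is positive, this also contains Bessel's
      inequality and with it the bound 1 on every \<open>c i\<close>.\<close>
    define b where "b = 1 - (\<Sum>i<N. (norm (c i))\<^sup>2)"
    have b: "\<eta> \<le> b" using pos[rule_format, of Q] dQ cQN BQQ by (simp add: b_def)
    have c1: "norm (c i) \<le> 1" if "i < N" for i
    proof -
      have "(norm (c i))\<^sup>2 \<le> (\<Sum>i<N. (norm (c i))\<^sup>2)"
        by (rule member_le_sum) (use that in auto)
      also have "\<dots> \<le> 1" using b \<eta> by (simp add: b_def)
      finally show ?thesis by (simp add: power2_le_iff_abs_le abs_square_le_1)
    qed
    have Qc: "norm (coeff Q j) \<le> 1 + N * K" for j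
    proof -
      have "norm (coeff Q j) \<le> norm (coeff x j) + (\<Sum>i<N. norm (c i * coeff (P i) j))"
        unfolding cQ by (rule order_trans[OF norm_triangle_ineq4]) (simp add: norm_sum)
      also have "\<dots> \<le> 1 + (\<Sum>i<N. 1 * K)"
        unfolding norm_mult by (intro add_mono sum_mono mult_mono c1 P(2)) (auto simp: x_def)
      finally show ?thesis by simp
    qed
    define P' where "P' = P(N := smult (of_real (1 / sqrt b)) Q)"
    show "\<exists>P. \<forall>k<Suc N. degree (P k) \<le> k \<and> (\<forall>j. norm (coeff (P k) j) \<le> K') \<and>
        (\<forall>i<Suc N. B (P k) (P i) = (if k = i then 1 else 0))"
    proof (intro exI[of _ P'] allI impI)
      fix k assume k: "k < Suc N"
      have b0: "b > 0" using b \<eta> by simp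
      have new: "norm (coeff (P' N) j) \<le> K'" for j
      proof -
        have "norm (coeff (P' N) j) = norm (coeff Q j) / sqrt b"
          using b0 by (simp add: P'_def norm_divide)
        also have "\<dots> \<le> (1 + N * K) / sqrt \<eta>"
          using b \<eta> K by (intro frac_le Qc) auto
        finally show ?thesis by (simp add: K'_def)
      qed
      have Bs': "B p (smult c r) = cnj c * B p r" for c p r
        proof -
        have "B p (smult c r) = cnj (B (smult c r) p)" by (rule herm[rule_format])
        also have "\<dots> = cnj c * cnj (B r p)" by (simp only: Bs complex_cnj_mult)
        also have "cnj (B r p) = B p r" by (rule herm[rule_format, symmetric])
        finally show ?thesis .
      qed
      have NN: "B (P' N) (P' N) = 1"
      proof -
        have "B (P' N) (P' N) = of_real ((1 / sqrt b) * (1 / sqrt b) * b)"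
          unfolding P'_def fun_upd_same Bs Bs' BQQ b_def[symmetric] of_real_mult complex_cnj_complex_of_real
          by (simp only: mult.assoc)
        also have "(1 / sqrt b) * (1 / sqrt b) * b = 1" using b0 by (simp add: field_simps)
        finally show ?thesis by simp
      qed
      show "degree (P' k) \<le> k \<and> (\<forall>j. norm (coeff (P' k) j) \<le> K') \<and>
        (\<forall>i<Suc N. B (P' k) (P' i) = (if k = i then 1 else 0))"
      proof (cases "k = N")
        case True
        have "B (P' N) (P' i) = 0" if "i < N" for i
          using that by (simp add: P'_def Bs BQP)
        then show ?thesis using True new NN
          by (auto simp: less_Suc_eq) (simp add: P'_def dQ)
      next
        case False
        then have k: "k < N" using k by simp
        have "B (P' k) (P' N) = 0" using k by (simp add: P'_def Bs' BPQ)
        then show ?thesis using k P(1)[OF k] P(2)[OF k] P(3)[OF k] False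
          by (auto simp: less_Suc_eq P'_def K'_def max.coboundedI1)
      qed
    qed
  qed
qed

section \<open>Small sets\<close>

text \<open>The fibres of the character are null, so around each single value the measure tends to 0
  with the radius, by continuity from above on the finite measure set \<open>E\<close>. Compactness
  of the range of relevant values makes the radius independent of \<open>r\<close>.\<close>

lemma measure_cis_fiber_small:
  fixes h :: "'a::euclidean_space"
  assumes E: "E \<in> lmeasurable" and h: "h \<noteq> 0" and \<kappa>: "0 < \<kappa>"
  shows "\<exists>\<delta>>0. \<forall>r. measure lebesgue {y \<in> E. norm (cis (h \<bullet> y) - r) < \<delta>} < \<kappa>"
proof -
  define w where "w y = cis (h \<bullet> y)" for y
  have cw: "continuous_on UNIV w" unfolding w_def by (intro continuous_intros)
  have lm: "{y \<in> E. norm (w y - r) < \<delta>} \<in> lmeasurable" for r \<delta>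
  proof -
    have "open {y. norm (w y - r) < \<delta>}"
      using cw by (intro open_Collect_less continuous_intros)
    then have "E \<inter> {y. norm (w y - r) < \<delta>} \<in> lmeasurable"
      using E by (intro fmeasurable_Int_fmeasurable) auto
    then show ?thesis by (simp add: Int_def)
  qed
  \<comment> \<open>A nonempty fibre lies in a countable union of parallel hyperplanes orthogonal to
    the nonzero vector \<open>h\<close>.\<close>
  have null: "negligible {y. w y = r}" for r
  proof (cases "\<exists>y0. w y0 = r")
    case True
    then obtain y0 where y0: "w y0 = r" by blast
    have "{y. w y = r} \<subseteq> (\<Union>n::int. {y. h \<bullet> y = h \<bullet> y0 + 2 * pi * n})"
    proof
      fix y assume "y \<in> {y. w y = r}"
      then have "exp (\<i> * complex_of_real (h \<bullet> y)) = exp (\<i> * complex_of_real (h \<bullet> y0))"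
        using y0 by (simp add: w_def cis_conv_exp)
      then obtain n :: int where "\<i> * complex_of_real (h \<bullet> y) = \<i> * complex_of_real (h \<bullet> y0) + (of_int (2 * n) * pi) * \<i>"
        unfolding exp_eq by blast
      then have "\<i> * complex_of_real (h \<bullet> y) = \<i> * complex_of_real (h \<bullet> y0 + 2 * pi * n)"
        by (simp add: algebra_simps)
      then have "h \<bullet> y = h \<bullet> y0 + 2 * pi * n"
        by (simp only: mult_cancel_left of_real_eq_iff complex_i_not_zero simp_thms)
      then show "y \<in> (\<Union>n::int. {y. h \<bullet> y = h \<bullet> y0 + 2 * pi * n})" by blast
    qed
    moreover have "negligible (\<Union>n::int. {y. h \<bullet> y = h \<bullet> y0 + 2 * pi * n})"
      by (rule negligible_countable_Union) (auto intro!: negligible_hyperplane h disjI1)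
    ultimately show ?thesis by (rule negligible_subset[rotated])
  next
    case False
    then have "{y. w y = r} = {}" by auto
    then show ?thesis by simp
  qed
  have loc: "\<exists>d>0. measure lebesgue {y \<in> E. norm (w y - r) < 2 * d} < \<kappa>" for r
  proof -
    define A where "A n = {y \<in> E. norm (w y - r) < inverse (real (Suc n))}" for n
    have dec: "decseq A"
    proof (rule decseq_SucI)
      show "A (Suc n) \<subseteq> A n" for n
      proof -
        have "inverse (real (Suc (Suc n))) \<le> inverse (real (Suc n))"
          by (intro le_imp_inverse_le) auto
        then show ?thesis unfolding A_def by (blast intro: less_le_trans)
      qed
    qed
    have sub: "(\<Inter>n. A n) \<subseteq> {y. w y = r}"
    proof
      fix y assume y: "y \<in> (\<Inter>n. A n)"
      have "norm (w y - r) = 0"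
      proof (rule ccontr)
        assume "norm (w y - r) \<noteq> 0"
        then have "norm (w y - r) > 0" by simp
        from reals_Archimedean[OF this] obtain n where "inverse (real (Suc n)) < norm (w y - r)" by blast
        moreover have "norm (w y - r) < inverse (real (Suc n))" using y by (simp add: A_def del: of_nat_Suc)
        ultimately show False by linarith
      qed
      then show "y \<in> {y. w y = r}" by simp
    qed
    have "(\<lambda>n. measure lebesgue (A n)) \<longlonglongrightarrow> measure lebesgue (\<Inter>n. A n)"
    proof (rule Lim_measure_decseq[OF _ dec])
      show "range A \<subseteq> sets lebesgue" using lm by (auto simp: A_def fmeasurableD)
      show "emeasure lebesgue (A n) \<noteq> \<infinity>" for n
        using lm[of r "inverse (real (Suc n))"] unfolding A_def
        by (simp only: infinity_ennreal_def fmeasurableD2 not_False_eq_True)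
    qed
    moreover have "measure lebesgue (\<Inter>n. A n) = 0"
      using negligible_subset[OF null sub] by (rule negligible_imp_measure0)
    ultimately have "\<forall>\<^sub>F n in sequentially. measure lebesgue (A n) < \<kappa>"
      using \<kappa> by (auto intro: order_tendstoD)
    then obtain n where "measure lebesgue (A n) < \<kappa>"
      by (auto simp: eventually_sequentially)
    then show ?thesis
      by (intro exI[of _ "inverse (real (Suc n)) / 2"]) (simp add: A_def del: of_nat_Suc)
  qed
  then obtain d where d: "\<And>r. d r > 0" "\<And>r. measure lebesgue {y \<in> E. norm (w y - r) < 2 * d r} < \<kappa>"
    by metis
  \<comment> \<open>The number \<open>e\<close> is a Lebesgue number of the cover and provides one
    radius for all centres of modulus at most 2. Centres farther out have distance at least 1 from
    the unit circle, which is the reason for the cap at 1 below.\<close>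
  have "compact (cball (0::complex) 2)" by simp
  moreover have "cball (0::complex) 2 \<subseteq> \<Union>((\<lambda>r. ball r (d r)) ` UNIV)"
    using d(1) centre_in_ball by blast
  ultimately obtain e where e: "e > 0" "\<forall>r\<in>cball 0 2. \<exists>G\<in>(\<lambda>r. ball r (d r)) ` UNIV. ball r e \<subseteq> G"
    by (rule Heine_Borel_lemma) auto
  show ?thesis
  proof (intro exI[of _ "min e 1"] conjI allI)
    show "0 < min e 1" using e by simp
    fix r :: complex
    show "measure lebesgue {y \<in> E. norm (cis (h \<bullet> y) - r) < min e 1} < \<kappa>"
    proof (cases "norm r \<le> 2")
      case True
      then obtain s where s: "ball r e \<subseteq> ball s (d s)" using e(2) by force
      have "{y \<in> E. norm (w y - r) < min e 1} \<subseteq> {y \<in> E. norm (w y - s) < 2 * d s}"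
      proof
        fix y assume "y \<in> {y \<in> E. norm (w y - r) < min e 1}"
        then have "y \<in> E" "w y \<in> ball r e" by (auto simp: dist_norm norm_minus_commute)
        then have "w y \<in> ball s (d s)" using s by blast
        then show "y \<in> {y \<in> E. norm (w y - s) < 2 * d s}"
          using \<open>y \<in> E\<close> d(1)[of s] by (auto simp: dist_norm norm_minus_commute)
      qed
      then have "measure lebesgue {y \<in> E. norm (w y - r) < min e 1} \<le> measure lebesgue {y \<in> E. norm (w y - s) < 2 * d s}"
        by (rule measure_mono_fmeasurable[OF _ fmeasurableD[OF lm] lm])
      then show ?thesis using d(2)[of s] by (simp add: w_def)
    next
      case False
      have "norm (cis (h \<bullet> y) - r) \<ge> 1" for y
        using False norm_triangle_ineq3[of "cis (h \<bullet> y)" r] by simp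
      then have "{y \<in> E. norm (cis (h \<bullet> y) - r) < min e 1} = {}"
        by (force simp: not_less intro: min.coboundedI2)
      then show ?thesis using \<kappa> by (simp only: measure_empty)
    qed
  qed
qed

text \<open>Induction on the degree by splitting off a root: where \<open>Q\<close> is small, the
  linear factor or the cofactor is small. The root may be anywhere, so the step rests on the
  estimate for linear factors being uniform in \<open>r\<close>; this is what makes \<eta> depend on
  the degree but not on \<open>Q\<close>.\<close>

lemma measure_poly_cis_small:
  fixes h :: "'a::euclidean_space"
  assumes E: "E \<in> lmeasurable" and h: "h \<noteq> 0" and \<kappa>: "0 < \<kappa>"
  shows "\<exists>\<eta>>0. \<forall>Q. lead_coeff Q = 1 \<and> degree Q = k \<longrightarrow>
    measure lebesgue {y \<in> E. norm (poly Q (cis (h \<bullet> y))) < \<eta>} < \<kappa>"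
  using \<kappa>
proof (induction k arbitrary: \<kappa>)
  case 0
  have "poly Q x = 1" if "lead_coeff Q = 1" "degree Q = 0" for Q :: "complex poly" and x
  proof -
    obtain a where "Q = [:a:]" using \<open>degree Q = 0\<close> by (rule degree_eq_zeroE)
    then show ?thesis using that(1) by simp
  qed
  then show ?case using 0 by (intro exI[of _ 1]) auto
next
  case (Suc k)
  obtain \<eta> where \<eta>: "\<eta> > 0" "\<And>Q. lead_coeff Q = 1 \<Longrightarrow> degree Q = k \<Longrightarrow>
    measure lebesgue {y \<in> E. norm (poly Q (cis (h \<bullet> y))) < \<eta>} < \<kappa> / 2"
    using Suc.IH[of "\<kappa> / 2"] Suc.prems by auto
  obtain \<delta> where \<delta>: "\<delta> > 0" "\<And>r. measure lebesgue {y \<in> E. norm (cis (h \<bullet> y) - r) < \<delta>} < \<kappa> / 2"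
    using measure_cis_fiber_small[OF E h, of "\<kappa> / 2"] Suc.prems by auto
  show ?case
  proof (intro exI[of _ "\<delta> * \<eta>"] conjI allI impI)
    show "0 < \<delta> * \<eta>" using \<eta> \<delta> by simp
    fix Q :: "complex poly" assume Q: "lead_coeff Q = 1 \<and> degree Q = Suc k"
    then obtain r where "poly Q r = 0"
      using fundamental_theorem_of_algebra[of Q] by (metis constant_degree Zero_not_Suc)
    then obtain P where P: "Q = [:- r, 1:] * P" by (metis dvdE poly_eq_0_iff_dvd)
    have "P \<noteq> 0" using P Q by auto
    then have dP: "degree P = k" using Q unfolding P by (subst (asm) degree_mult_eq) auto
    have lP: "lead_coeff P = 1" using Q unfolding P by (simp only: lead_coeff_mult) simp
    have lm: "E \<inter> {y. norm (poly R (cis (h \<bullet> y))) < c} \<in> lmeasurable" for R :: "complex poly" and c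
    proof -
      have "open {y. norm (poly R (cis (h \<bullet> y))) < c}"
        by (intro open_Collect_less continuous_intros)
      then show ?thesis using E by (intro fmeasurable_Int_fmeasurable) auto
    qed
    have sub: "E \<inter> {y. norm (poly Q (cis (h \<bullet> y))) < \<delta> * \<eta>}
      \<subseteq> (E \<inter> {y. norm (poly [:- r, 1:] (cis (h \<bullet> y))) < \<delta>}) \<union> (E \<inter> {y. norm (poly P (cis (h \<bullet> y))) < \<eta>})"
    proof safe
      fix y assume y: "y \<in> E" "norm (poly Q (cis (h \<bullet> y))) < \<delta> * \<eta>" "\<not> norm (poly P (cis (h \<bullet> y))) < \<eta>"
      show "norm (poly [:- r, 1:] (cis (h \<bullet> y))) < \<delta>"
      proof (rule ccontr)
        assume "\<not> ?thesis"
        then have "\<delta> * \<eta> \<le> norm (poly [:- r, 1:] (cis (h \<bullet> y))) * norm (poly P (cis (h \<bullet> y)))"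
          using y \<eta> \<delta> by (intro mult_mono) auto
        then show False using y unfolding P poly_mult norm_mult by linarith
      qed
    qed
    have "measure lebesgue (E \<inter> {y. norm (poly Q (cis (h \<bullet> y))) < \<delta> * \<eta>})
      \<le> measure lebesgue (E \<inter> {y. norm (poly [:- r, 1:] (cis (h \<bullet> y))) < \<delta>}) + measure lebesgue (E \<inter> {y. norm (poly P (cis (h \<bullet> y))) < \<eta>})"
      by (rule order_trans[OF measure_mono_fmeasurable[OF sub] measure_Un_le])
         (use lm in \<open>auto simp del: poly_pCons intro!: fmeasurable.Un simp: fmeasurableD\<close>)
    also have "\<dots> < \<kappa> / 2 + \<kappa> / 2"
      using \<eta>(2)[OF lP dP] \<delta>(2)[of r] by (intro add_strict_mono) (simp_all add: Int_def)
    finally show "measure lebesgue {y \<in> E. norm (poly Q (cis (h \<bullet> y))) < \<delta> * \<eta>} < \<kappa>"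
      by (simp add: Int_def)
  qed
qed

text \<open>A compact part of \<open>F\<close> of almost full measure can be moved slightly without
  leaving an open set that is barely larger than \<open>F\<close>. The rest of \<open>F\<close> is
  counted once for each of the \<open>N\<close> translates, so its measure is chosen small compared
  with 1/N.\<close>

lemma measure_union_translates:
  fixes F :: "'a::euclidean_space set"
  assumes F: "F \<in> lmeasurable"
  shows "\<exists>\<delta>>0. \<forall>b. norm b < \<delta> \<longrightarrow> (\<Union>j<N. (+) (real j *\<^sub>R b) ` F) \<in> lmeasurable \<and>
    measure lebesgue (\<Union>j<N. (+) (real j *\<^sub>R b) ` F) \<le> measure lebesgue F + 1"
proof -
  \<comment> \<open>The translated remainders cost at most N * \<epsilon> <= 1/2; the open set
    \<open>U\<close> takes the other half of the allowance 1.\<close>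
  define \<epsilon> where "\<epsilon> = 1 / (2 * (real N + 1))"
  have \<epsilon>: "\<epsilon> > 0" by (simp add: \<epsilon>_def)
  have Fs: "F \<in> sets lebesgue" using F by (rule fmeasurableD)
  obtain K0 where K0: "closed K0" "K0 \<subseteq> F" "F - K0 \<in> lmeasurable" "emeasure lebesgue (F - K0) < ennreal (\<epsilon> / 2)"
    using sets_lebesgue_inner_closed[OF Fs, of "\<epsilon> / 2"] \<epsilon> by auto
  have K0m: "K0 \<in> lmeasurable" using K0 F by (intro fmeasurableI2[OF F]) (auto simp: closed_def)
  have "(\<lambda>n. measure lebesgue (K0 - cball 0 (real n))) \<longlonglongrightarrow> measure lebesgue (\<Inter>n. K0 - cball 0 (real n))"
  proof (rule Lim_measure_decseq)
    show "range (\<lambda>n. K0 - cball 0 (real n)) \<subseteq> sets lebesgue" using K0 by (auto intro!: sets.Diff)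
    show "decseq (\<lambda>n. K0 - cball 0 (real n))" by (auto simp: decseq_def)
    show "emeasure lebesgue (K0 - cball 0 (real n)) \<noteq> \<infinity>" for n
      using fmeasurableD2[OF fmeasurable.Diff[OF K0m, of "cball 0 (real n)"]] by auto
  qed
  moreover have "(\<Inter>n. K0 - cball 0 (real n)) = {}"
    by (auto simp: real_arch_simple)
  ultimately have "(\<lambda>n. measure lebesgue (K0 - cball 0 (real n))) \<longlonglongrightarrow> 0"
    by (simp only: measure_empty)
  then have "\<forall>\<^sub>F n in sequentially. measure lebesgue (K0 - cball 0 (real n)) < \<epsilon> / 2"
    using \<epsilon> by (intro order_tendstoD) auto
  then obtain n where n: "measure lebesgue (K0 - cball 0 (real n)) < \<epsilon> / 2"
    by (auto simp: eventually_sequentially)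
  define K where "K = K0 \<inter> cball 0 (real n)"
  have K: "compact K" "K \<subseteq> F" using K0 by (auto simp: K_def closed_Int_compact)
  have Km: "K \<in> lmeasurable" using K(1) by (rule lmeasurable_compact)
  have FK: "F - K \<in> lmeasurable" using F Km by (intro fmeasurable.Diff) (auto simp: fmeasurableD)
  have mFK: "measure lebesgue (F - K) < \<epsilon>"
  proof -
    have D: "K0 - cball 0 (real n) \<in> lmeasurable" using K0m by (intro fmeasurable.Diff) auto
    have "measure lebesgue (F - K) \<le> measure lebesgue ((F - K0) \<union> (K0 - cball 0 (real n)))"
      by (rule measure_mono_fmeasurable) (use FK D K0 in \<open>auto simp: K_def fmeasurableD intro!: fmeasurable.Un\<close>)
    also have "\<dots> \<le> measure lebesgue (F - K0) + measure lebesgue (K0 - cball 0 (real n))"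
      by (rule measure_Un_le) (use D K0 in \<open>auto simp: fmeasurableD\<close>)
    also have "measure lebesgue (F - K0) < \<epsilon> / 2"
      using K0(3,4) \<epsilon> by (simp add: emeasure_eq_measure2 ennreal_less_iff)
    finally show ?thesis using n by linarith
  qed
  obtain U where U: "open U" "F \<subseteq> U" "U \<in> lmeasurable" "measure lebesgue U \<le> measure lebesgue F + 1/2"
  proof -
    obtain T where T: "open T" "F \<subseteq> T" "T - F \<in> lmeasurable" "emeasure lebesgue (T - F) < ennreal (1/2)"
      using sets_lebesgue_outer_open[OF Fs, of "1/2"] by auto
    have "T = F \<union> (T - F)" using T by blast
    moreover have "F \<union> (T - F) \<in> lmeasurable" using F T by (intro fmeasurable.Un)
    moreover have "measure lebesgue (F \<union> (T - F)) \<le> measure lebesgue F + measure lebesgue (T - F)"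
      by (rule measure_Un_le) (use F T in \<open>auto simp: fmeasurableD\<close>)
    moreover have "measure lebesgue (T - F) < 1/2"
      using T(3,4) unfolding emeasure_eq_measure2[OF T(3)] by (subst (asm) ennreal_less_iff) auto
    ultimately show thesis using T that[of T] by auto
  qed
  have "K \<subseteq> U" using K U by blast
  then obtain e where e: "e > 0" "(\<Union>x\<in>K. ball x e) \<subseteq> U"
    using compact_subset_open_imp_ball_epsilon_subset[OF K(1) U(1)] by blast
  show ?thesis
  \<comment> \<open>With this bound every vector j * b with j < N is shorter than \<open>e\<close>,
    so each translate of the compact part stays in \<open>U\<close>.\<close>
  proof (intro exI[of _ "e / (real N + 1)"] conjI allI impI)
    show "0 < e / (real N + 1)" using e by simp
    fix b :: 'a assume b: "norm b < e / (real N + 1)"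
    have tm: "(+) (real j *\<^sub>R b) ` A \<in> lmeasurable" if "A \<in> lmeasurable" for j A
      using that by (rule measurable_translation)
    show um: "(\<Union>j<N. (+) (real j *\<^sub>R b) ` F) \<in> lmeasurable"
      by (rule fmeasurable.finite_UN[OF finite_lessThan tm[OF F]])
    have um': "(\<Union>j<N. (+) (real j *\<^sub>R b) ` (F - K)) \<in> lmeasurable"
      by (rule fmeasurable.finite_UN[OF finite_lessThan tm[OF FK]])
    have sub: "(\<Union>j<N. (+) (real j *\<^sub>R b) ` F) \<subseteq> U \<union> (\<Union>j<N. (+) (real j *\<^sub>R b) ` (F - K))"
    proof
      fix y assume "y \<in> (\<Union>j<N. (+) (real j *\<^sub>R b) ` F)"
      then obtain j x where j: "j < N" "x \<in> F" "y = real j *\<^sub>R b + x" by auto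
      show "y \<in> U \<union> (\<Union>j<N. (+) (real j *\<^sub>R b) ` (F - K))"
      proof (cases "x \<in> K")
        case True
        have "norm (real j *\<^sub>R b) \<le> (real N + 1) * norm b" using j by (simp add: mult_right_mono)
        also have "\<dots> < e" using b by (simp add: field_simps)
        finally have "y \<in> ball x e" using j by (simp add: dist_norm)
        then show ?thesis using e True by blast
      next
        case False
        then show ?thesis using j by blast
      qed
    qed
    have "measure lebesgue (\<Union>j<N. (+) (real j *\<^sub>R b) ` F) \<le> measure lebesgue (U \<union> (\<Union>j<N. (+) (real j *\<^sub>R b) ` (F - K)))"
      by (rule measure_mono_fmeasurable[OF sub]) (use um um' U in \<open>auto simp: fmeasurableD intro!: fmeasurable.Un\<close>)
    also have "\<dots> \<le> measure lebesgue U + measure lebesgue (\<Union>j<N. (+) (real j *\<^sub>R b) ` (F - K))"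
      by (rule measure_Un_le) (use um' U in \<open>auto simp: fmeasurableD\<close>)
    also have "measure lebesgue (\<Union>j<N. (+) (real j *\<^sub>R b) ` (F - K)) \<le> (\<Sum>j<N. measure lebesgue ((+) (real j *\<^sub>R b) ` (F - K)))"
      by (rule measure_UNION_le) (use tm[OF FK] in \<open>auto simp: fmeasurableD\<close>)
    also have "\<dots> = N * measure lebesgue (F - K)" by (simp add: measure_translation)
    also have "\<dots> \<le> N * \<epsilon>" using mFK by (intro mult_left_mono) auto
    also have "\<dots> \<le> 1/2" by (simp add: \<epsilon>_def field_simps)
    finally show "measure lebesgue (\<Union>j<N. (+) (real j *\<^sub>R b) ` F) \<le> measure lebesgue F + 1"
      using U(4) by linarith
  qed
qed

section \<open>Square-integrable functions and unitary operators\<close>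

lemma norm_add_square_le:
  fixes a b :: "'a::real_normed_vector"
  shows "(norm (a + b))\<^sup>2 \<le> 2 * (norm a)\<^sup>2 + 2 * (norm b)\<^sup>2"
proof -
  have "(norm (a + b))\<^sup>2 \<le> (norm a + norm b)\<^sup>2"
    by (intro power_mono norm_triangle_ineq) simp
  also have "\<dots> \<le> 2 * (norm a)\<^sup>2 + 2 * (norm b)\<^sup>2"
    using sum_squares_bound[of "norm a" "norm b"] by (simp add: power2_sum)
  finally show ?thesis .
qed

lemma AE_lebesgue_translate:
  fixes t :: "'a::euclidean_space"
  assumes "AE x in lebesgue. P x"
  shows "AE x in lebesgue. P (x - t)"
proof -
  have "AE x in distr lborel borel ((+) (- t)). P x"
    unfolding lborel_distr_plus using assms by (simp only: AE_completion_iff)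
  from AE_distrD[OF _ this] show ?thesis
    by (simp add: AE_completion_iff)
qed

text \<open>Elements of \<open>L2\<close> are Lebesgue measurable only, whereas the translation and
  ball average arguments run over \<open>lborel\<close>; Borel representatives connect the
  two.\<close>

lemma lebesgue_ex_borel_complex:
  fixes f :: "'a::euclidean_space \<Rightarrow> complex"
  assumes "f \<in> borel_measurable lebesgue"
  obtains g where "g \<in> borel_measurable borel" "AE x in lebesgue. f x = g x"
proof -
  have "(\<lambda>x. Re (f x)) \<in> borel_measurable lebesgue" "(\<lambda>x. Im (f x)) \<in> borel_measurable lebesgue"
    using assms by measurable
  from this[THEN completion_ex_borel_measurable_real] obtain u v where
    u: "u \<in> borel_measurable lborel" "AE x in lborel. Re (f x) = u x" and
    v: "v \<in> borel_measurable lborel" "AE x in lborel. Im (f x) = v x" by blast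
  show thesis
  proof
    show "(\<lambda>x. Complex (u x) (v x)) \<in> borel_measurable borel"
      using u(1) v(1) unfolding Complex_eq by simp
    show "AE x in lebesgue. f x = Complex (u x) (v x)"
      unfolding AE_completion_iff using u(2) v(2) by eventually_elim (simp add: complex_eq_iff)
  qed
qed

lemma borel_measurable_lebesgue_translate:
  fixes f :: "'a::euclidean_space \<Rightarrow> complex"
  assumes "f \<in> borel_measurable lebesgue"
  shows "(\<lambda>x. f (x - t)) \<in> borel_measurable lebesgue"
proof -
  have "(\<lambda>x. - t + (\<Sum>j\<in>Basis. (1 * (x \<bullet> j)) *\<^sub>R j)) \<in> lebesgue \<rightarrow>\<^sub>M lebesgue"
    by (rule lebesgue_affine_measurable) simp
  then have "(\<lambda>x. x - t) \<in> lebesgue \<rightarrow>\<^sub>M lebesgue"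
    by (simp add: euclidean_representation)
  then show ?thesis using assms by (rule measurable_compose)
qed

lemma nn_integral_lebesgue_translate:
  fixes f :: "'a::euclidean_space \<Rightarrow> complex" and h :: "complex \<Rightarrow> ennreal"
  assumes "f \<in> borel_measurable lebesgue" and [measurable]: "h \<in> borel_measurable borel"
  shows "(\<integral>\<^sup>+x. h (f (x - t)) \<partial>lebesgue) = (\<integral>\<^sup>+x. h (f x) \<partial>lebesgue)"
proof -
  obtain g where g [measurable]: "g \<in> borel_measurable borel" and ae: "AE x in lebesgue. f x = g x"
    using lebesgue_ex_borel_complex[OF assms(1)] .
  have "(\<integral>\<^sup>+x. h (f (x - t)) \<partial>lebesgue) = (\<integral>\<^sup>+x. h (g (x - t)) \<partial>lebesgue)"
    using AE_lebesgue_translate[OF ae, of t] by (intro nn_integral_cong_AE) (auto elim: eventually_mono)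
  also have "\<dots> = (\<integral>\<^sup>+x. h (g (- t + x)) \<partial>lborel)" by (simp add: nn_integral_completion)
  also have "\<dots> = (\<integral>\<^sup>+x. h (g x) \<partial>distr lborel borel ((+) (- t)))"
    by (subst nn_integral_distr) auto
  also have "\<dots> = (\<integral>\<^sup>+x. h (g x) \<partial>lebesgue)" by (simp only: lborel_distr_plus nn_integral_completion)
  also have "\<dots> = (\<integral>\<^sup>+x. h (f x) \<partial>lebesgue)"
    using ae by (intro nn_integral_cong_AE) (auto elim: eventually_mono)
  finally show ?thesis .
qed

section \<open>Closure properties of square-integrable functions\<close>

lemma L2_measurable: "f \<in> L2 \<Longrightarrow> f \<in> borel_measurable lebesgue"
  and L2_integrable: "f \<in> L2 \<Longrightarrow> integrable lebesgue (\<lambda>x. (norm (f x))\<^sup>2)"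
  by (auto simp: L2_def)

lemma L2_translate:
  assumes "f \<in> L2"
  shows "(\<lambda>x. f (x - t)) \<in> L2"
proof -
  have "(\<integral>\<^sup>+x. ennreal ((norm (f (x - t)))\<^sup>2) \<partial>lebesgue) = (\<integral>\<^sup>+x. ennreal ((norm (f x))\<^sup>2) \<partial>lebesgue)"
    by (rule nn_integral_lebesgue_translate) (use L2_measurable[OF assms] in auto)
  moreover have "(\<lambda>x. f (x - t)) \<in> borel_measurable lebesgue"
    by (rule borel_measurable_lebesgue_translate[OF L2_measurable[OF assms]])
  ultimately show ?thesis
    using L2_integrable[OF assms] by (auto simp: L2_def integrable_iff_bounded)
qed

lemma L2_dominated:
  assumes f: "f \<in> borel_measurable lebesgue" and g: "g \<in> L2" and le: "\<And>x. norm (f x) \<le> c * norm (g x)"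
  shows "f \<in> L2"
proof -
  have "integrable lebesgue (\<lambda>x. (norm (f x))\<^sup>2)"
  proof (rule Bochner_Integration.integrable_bound)
    show "integrable lebesgue (\<lambda>x. c\<^sup>2 * (norm (g x))\<^sup>2)" using L2_integrable[OF g] by simp
    show "(\<lambda>x. (norm (f x))\<^sup>2) \<in> borel_measurable lebesgue" using f by simp
    show "AE x in lebesgue. norm ((norm (f x))\<^sup>2) \<le> norm (c\<^sup>2 * (norm (g x))\<^sup>2)"
      using power_mono[OF le norm_ge_zero, of _ 2] by (auto simp: power_mult_distrib)
  qed
  then show ?thesis using f by (simp add: L2_def)
qed

lemma L2_mult_bounded:
  assumes "f \<in> L2" "m \<in> borel_measurable lebesgue" "\<And>x. norm (m x) \<le> c"
  shows "(\<lambda>x. m x * f x) \<in> L2"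
  by (rule L2_dominated[of _ f c])
     (use assms L2_measurable in \<open>auto simp: norm_mult mult_right_mono intro!: borel_measurable_times\<close>)

lemma L2_cmult: "f \<in> L2 \<Longrightarrow> (\<lambda>x. c * f x) \<in> L2"
  by (rule L2_mult_bounded[where c="norm c"]) auto

lemma L2_indicator: "f \<in> L2 \<Longrightarrow> A \<in> sets lebesgue \<Longrightarrow> (\<lambda>x. indicator A x * f x) \<in> L2"
  by (rule L2_mult_bounded[where c=1]) (auto simp: indicator_def)

lemma L2_add:
  assumes "f \<in> L2" "g \<in> L2"
  shows "(\<lambda>x. f x + g x) \<in> L2"
proof -
  have m: "(\<lambda>x. f x + g x) \<in> borel_measurable lebesgue"
    using assms L2_measurable by (intro borel_measurable_add) auto
  have "integrable lebesgue (\<lambda>x. (norm (f x + g x))\<^sup>2)"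
  proof (rule Bochner_Integration.integrable_bound)
    show "integrable lebesgue (\<lambda>x. 2 * (norm (f x))\<^sup>2 + 2 * (norm (g x))\<^sup>2)"
      using assms L2_integrable by (intro Bochner_Integration.integrable_add integrable_mult_right) auto
    show "(\<lambda>x. (norm (f x + g x))\<^sup>2) \<in> borel_measurable lebesgue" using m by simp
    show "AE x in lebesgue. norm ((norm (f x + g x))\<^sup>2) \<le> norm (2 * (norm (f x))\<^sup>2 + 2 * (norm (g x))\<^sup>2)"
      using norm_add_square_le by (intro always_eventually allI) simp
  qed
  then show ?thesis using m by (simp add: L2_def)
qed

lemma L2_zero: "(\<lambda>x. 0) \<in> L2"
  by (simp add: L2_def)

lemma L2_sum:
  assumes "finite I" "\<And>i. i \<in> I \<Longrightarrow> f i \<in> L2"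
  shows "(\<lambda>x. \<Sum>i\<in>I. f i x) \<in> L2"
  using assms by (induction I rule: finite_induct) (auto simp: L2_zero intro: L2_add)

lemma L2_diff: "f \<in> L2 \<Longrightarrow> g \<in> L2 \<Longrightarrow> (\<lambda>x. f x - g x) \<in> L2"
  using L2_add[of f "\<lambda>x. - 1 * g x"] L2_cmult[of g "- 1"] by simp

lemma L2_inner_integrable:
  assumes "f \<in> L2" "g \<in> L2"
  shows "integrable lebesgue (\<lambda>x. f x * cnj (g x))"
proof (rule Bochner_Integration.integrable_bound)
  show "integrable lebesgue (\<lambda>x. (norm (f x))\<^sup>2 + (norm (g x))\<^sup>2)"
    using assms L2_integrable by (intro Bochner_Integration.integrable_add) auto
  show "(\<lambda>x. f x * cnj (g x)) \<in> borel_measurable lebesgue"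
    using assms[THEN L2_measurable] by measurable
  have "norm a * norm b \<le> (norm a)\<^sup>2 + (norm b)\<^sup>2" for a b :: complex
    using sum_squares_bound[of "norm a" "norm b"] mult_nonneg_nonneg[OF norm_ge_zero[of a] norm_ge_zero[of b]]
    unfolding mult.assoc by linarith
  then show "AE x in lebesgue. norm (f x * cnj (g x)) \<le> norm ((norm (f x))\<^sup>2 + (norm (g x))\<^sup>2)"
    by (simp add: norm_mult)
qed

lemma L2_inner_self: "L2_inner f f = of_real (\<integral>x. (norm (f x))\<^sup>2 \<partial>lebesgue)"
  unfolding L2_inner_def complex_norm_square[symmetric] by (rule integral_complex_of_real)

section \<open>Unitary operators, with equations up to null sets\<close>

lemma unitary_L2_mem: "unitary_L2 T \<Longrightarrow> f \<in> L2 \<Longrightarrow> T f \<in> L2"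
  by (simp add: unitary_L2_def)

lemma unitary_norm_square:
  assumes "unitary_L2 T" "f \<in> L2"
  shows "(\<integral>x. (norm (T f x))\<^sup>2 \<partial>lebesgue) = (\<integral>x. (norm (f x))\<^sup>2 \<partial>lebesgue)"
proof -
  have "L2_inner (T f) (T f) = L2_inner f f" using assms by (simp add: unitary_L2_def)
  then show ?thesis unfolding L2_inner_self by (simp only: of_real_eq_iff)
qed

lemma unitary_cmult:
  "unitary_L2 T \<Longrightarrow> f \<in> L2 \<Longrightarrow> AE x in lebesgue. T (\<lambda>x. c * f x) x = c * T f x"
  unfolding unitary_L2_def L2_eq_def by blast

lemma unitary_add:
  "unitary_L2 T \<Longrightarrow> f \<in> L2 \<Longrightarrow> g \<in> L2 \<Longrightarrow> AE x in lebesgue. T (\<lambda>x. f x + g x) x = T f x + T g x"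
  unfolding unitary_L2_def L2_eq_def by blast

lemma unitary_sum:
  assumes T: "unitary_L2 T" and "finite I" and "\<And>i. i \<in> I \<Longrightarrow> f i \<in> L2"
  shows "AE x in lebesgue. T (\<lambda>x. \<Sum>i\<in>I. a i * f i x) x = (\<Sum>i\<in>I. a i * T (f i) x)"
  using assms(2,3)
proof (induction I rule: finite_induct)
  case empty
  show ?case using unitary_cmult[OF T L2_zero, of 0] by simp
next
  case (insert i I)
  have "AE x in lebesgue. T (\<lambda>x. a i * f i x + (\<Sum>i\<in>I. a i * f i x)) x = T (\<lambda>x. a i * f i x) x + T (\<lambda>x. \<Sum>i\<in>I. a i * f i x) x"
    using insert by (intro unitary_add[OF T] L2_cmult L2_sum) auto
  moreover have "AE x in lebesgue. T (\<lambda>x. a i * f i x) x = a i * T (f i) x"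
    using insert by (intro unitary_cmult[OF T]) auto
  moreover have "AE x in lebesgue. T (\<lambda>x. \<Sum>i\<in>I. a i * f i x) x = (\<Sum>i\<in>I. a i * T (f i) x)"
    using insert by auto
  ultimately show ?case
    by eventually_elim (use insert in simp)
qed

lemma unitary_diff_norm_square:
  assumes T: "unitary_L2 T" and f: "f \<in> L2" and g: "g \<in> L2"
  shows "(\<integral>x. (norm (f x - g x))\<^sup>2 \<partial>lebesgue) = (\<integral>x. (norm (T f x - T g x))\<^sup>2 \<partial>lebesgue)"
proof -
  have "(\<integral>x. (norm (f x - g x))\<^sup>2 \<partial>lebesgue) = (\<integral>x. (norm (T (\<lambda>x. f x - g x) x))\<^sup>2 \<partial>lebesgue)"
    by (rule unitary_norm_square[OF T L2_diff[OF f g], symmetric])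
  also have "\<dots> = (\<integral>x. (norm (T f x - T g x))\<^sup>2 \<partial>lebesgue)"
  proof (rule integral_cong_AE)
    have "AE x in lebesgue. T (\<lambda>x. f x + - 1 * g x) x = T f x + T (\<lambda>x. - 1 * g x) x"
      by (rule unitary_add[OF T f L2_cmult[OF g]])
    moreover have "AE x in lebesgue. T (\<lambda>x. - 1 * g x) x = - 1 * T g x" by (rule unitary_cmult[OF T g])
    ultimately show "AE x in lebesgue. (norm (T (\<lambda>x. f x - g x) x))\<^sup>2 = (norm (T f x - T g x))\<^sup>2"
      by eventually_elim simp
  qed (use L2_integrable[OF unitary_L2_mem[OF T L2_diff[OF f g]]]
        L2_integrable[OF L2_diff[OF unitary_L2_mem[OF T f] unitary_L2_mem[OF T g]]] in auto)
  finally show ?thesis .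
qed

text \<open>Differences keep their norm under an isometry. This identifies the preimage that
  \<open>L2_inverse\<close> happens to choose.\<close>

lemma unitary_AE_inj:
  assumes T: "unitary_L2 T" and f: "f \<in> L2" and g: "g \<in> L2" and eq: "L2_eq (T f) (T g)"
  shows "L2_eq f g"
proof -
  have "(\<integral>x. (norm (T f x - T g x))\<^sup>2 \<partial>lebesgue) = 0"
    using eq by (intro integral_eq_zero_AE) (auto simp: L2_eq_def elim: eventually_mono)
  then have "(\<integral>x. (norm (f x - g x))\<^sup>2 \<partial>lebesgue) = 0"
    by (simp only: unitary_diff_norm_square[OF T f g])
  then have "AE x in lebesgue. (norm (f x - g x))\<^sup>2 = 0"
    by (subst (asm) integral_nonneg_eq_0_iff_AE) (auto intro: L2_integrable[OF L2_diff[OF f g]])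
  then show ?thesis unfolding L2_eq_def by eventually_elim simp
qed

section \<open>The Schroedinger representation and its intertwining\<close>

lemma norm_schroedinger_rep: "norm (schroedinger_rep z \<tau> f y) = norm (f (y - position z))"
  by (simp add: schroedinger_rep_def norm_mult)

lemma schroedinger_rep_L2:
  assumes "f \<in> L2"
  shows "schroedinger_rep z \<tau> f \<in> L2"
proof -
  have "(\<lambda>y. exp (2 * pi * \<i> * \<tau>) * exp (- (\<i> * pi * (position z \<bullet> momentum z))) *
     exp (2 * pi * \<i> * (momentum z \<bullet> y))) \<in> borel_measurable lebesgue"
    by (intro measurable_completion, simp only: measurable_lborel2)
       (intro borel_measurable_continuous_onI continuous_intros)
  from L2_mult_bounded[OF L2_translate[OF assms, of "position z"] this, of 1]
  show ?thesis unfolding schroedinger_rep_def by (simp add: norm_mult)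
qed

text \<open>The definition of \<open>metaplectic\<close> applies the representation to a chosen
  preimage. For the function \<open>T f\<close> that preimage agrees with \<open>f\<close> almost
  everywhere by injectivity, and \<open>L2_inverse\<close> disappears from all later
  arguments.\<close>

lemma metaplectic_intertwines:
  assumes m: "metaplectic S T" and f: "f \<in> L2"
  shows "AE y in lebesgue. T (schroedinger_rep z \<tau> f) y = schroedinger_rep (S *v z) \<tau> (T f) y"
proof -
  have T: "unitary_L2 T" using m by (simp add: metaplectic_def)
  define g where "g = L2_inverse T (T f)"
  have "g \<in> L2 \<and> L2_eq (T g) (T f)"
    unfolding g_def L2_inverse_def by (rule someI[of _ f]) (simp add: f L2_eq_def)
  then have g: "g \<in> L2" "L2_eq g f" using unitary_AE_inj[OF T _ f] by auto
  have "L2_eq (schroedinger_rep z \<tau> g) (schroedinger_rep z \<tau> f)"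
    using AE_lebesgue_translate[of "\<lambda>x. g x = f x" "position z"] g(2)
    unfolding L2_eq_def schroedinger_rep_def by (auto elim: eventually_mono)
  then have "L2_eq (T (schroedinger_rep z \<tau> g)) (T (schroedinger_rep z \<tau> f))"
    using T g f schroedinger_rep_L2 unfolding unitary_L2_def by blast
  moreover have "L2_eq (T (schroedinger_rep z \<tau> g)) (schroedinger_rep (S *v z) \<tau> (T f))"
    using m unitary_L2_mem[OF T f] unfolding metaplectic_def g_def by blast
  ultimately show ?thesis
    unfolding L2_eq_def by eventually_elim simp
qed

text \<open>At these points of phase space the representation is a pure modulation, and the block B
  alone decides by which vector its conjugate under \<open>T\<close> translates.\<close>

definition frequency :: "real ^ 'n \<Rightarrow> real ^ ('n::finite + 'n)" where
  "frequency \<theta> = (\<chi> i. case i of Inl _ \<Rightarrow> 0 | Inr k \<Rightarrow> \<theta> $ k)"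

lemma momentum_frequency [simp]: "momentum (frequency \<theta>) = \<theta>"
  and position_frequency [simp]: "position (frequency \<theta>) = 0"
  by (simp_all add: momentum_def position_def frequency_def vec_eq_iff)

lemma position_block_mat_frequency:
  fixes A B C D :: "real ^ 'n::finite ^ 'n"
  shows "position (block_mat A B C D *v frequency \<theta>) = B *v \<theta>"
  unfolding position_def block_mat_def frequency_def matrix_vector_mult_def vec_eq_iff
  by (simp flip: UNIV_Plus_UNIV) (subst sum.Plus, auto)

lemma schroedinger_rep_frequency:
  "schroedinger_rep (frequency \<theta>) 0 f = (\<lambda>y. cis (2 * pi * (\<theta> \<bullet> y)) * f y)"
  by (simp add: schroedinger_rep_def cis_conv_exp fun_eq_iff mult_ac)

section \<open>The dispersive estimate\<close>

text \<open>A bound from L^1 to L^infinity for the inverse of \<open>T\<close>, with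
  \<open>c\<close> in place of the squared norm. The image is represented by a function
  \<open>g\<close>, since later it is given only as a cut-off, up to a null set.\<close>

definition dispersive :: "real \<Rightarrow> (('a::euclidean_space \<Rightarrow> complex) \<Rightarrow> ('a \<Rightarrow> complex)) \<Rightarrow> bool" where
  "dispersive c T \<longleftrightarrow> 0 \<le> c \<and> (\<forall>f\<in>L2. \<forall>g. L2_eq (T f) g \<longrightarrow> integrable lebesgue g \<longrightarrow>
    (AE x in lebesgue. (norm (f x))\<^sup>2 \<le> c * (\<integral>x. norm (g x) \<partial>lebesgue)\<^sup>2))"

text \<open>The Fourier transform of |f|^2 consists of inner products of modulated copies of
  \<open>f\<close> with \<open>f\<close>. Under \<open>T\<close> the modulation by L t becomes a
  translation by exactly \<open>t\<close>, up to factors of modulus 1, so such an inner product is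
  at most the autocorrelation of |T f| at \<open>t\<close>. The bound on ball averages then becomes
  a pointwise one.\<close>

lemma dispersive_estimate:
  fixes T :: "(real ^ 'n::finite \<Rightarrow> complex) \<Rightarrow> (real ^ 'n \<Rightarrow> complex)"
  assumes m: "metaplectic S T" and free: "free_matrix S"
  shows "\<exists>c. dispersive c T"
proof -
  obtain A B C D where S: "S = block_mat A B C D" and B: "invertible B"
    using free by (auto simp: free_matrix_def)
  have T: "unitary_L2 T" using m by (simp add: metaplectic_def)
  \<comment> \<open>A right inverse is taken so that every translation \<open>t\<close> comes from a
    frequency, namely L t with B (L t) = t.\<close>
  obtain B' where B': "B ** B' = mat 1" using B by (auto simp: invertible_def)
  define L where "L t = B' *v t" for t
  have BL: "B *v L t = t" for t
    unfolding L_def matrix_vector_mul_assoc B' by simp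
  have L: "linear L" unfolding L_def by simp
  obtain \<kappa> where \<kappa>: "0 < \<kappa>" "\<And>t. norm (L t) \<le> \<kappa> * norm t"
    using linear_bounded_pos[OF L] by blast
  define c where "c = 4 * (6 * \<kappa>) ^ DIM(real ^ 'n) / (measure lborel (ball (0::real ^ 'n) 1))\<^sup>2"
  have c: "c \<ge> 0" using \<kappa> by (simp add: c_def)
  show ?thesis
    unfolding dispersive_def
  proof (intro exI[of _ c] conjI ballI allI impI)
    show "0 \<le> c" by (rule c)
    fix f g :: "real ^ 'n \<Rightarrow> complex"
    assume f: "f \<in> L2" and eq: "L2_eq (T f) g" and gi: "integrable lebesgue g"
    obtain f' where f' [measurable]: "f' \<in> borel_measurable borel" and ff: "AE x in lebesgue. f x = f' x"
      using lebesgue_ex_borel_complex[OF L2_measurable[OF f]] .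
    obtain g' where g' [measurable]: "g' \<in> borel_measurable borel" and gg: "AE x in lebesgue. g x = g' x"
      using lebesgue_ex_borel_complex[OF borel_measurable_integrable[OF gi]] .
    have Tg: "AE x in lebesgue. T f x = g' x" using eq gg unfolding L2_eq_def by eventually_elim simp
    define p where "p x = (norm (f' x))\<^sup>2" for x
    define q where "q x = norm (g' x)" for x
    have pm [measurable]: "p \<in> borel_measurable borel" and qm [measurable]: "q \<in> borel_measurable borel"
      unfolding p_def q_def by measurable
    have p: "integrable lborel p"
    proof -
      have "integrable lebesgue p"
      proof (rule integrable_cong_AE_imp[OF L2_integrable[OF f]])
        show "p \<in> borel_measurable lebesgue" by (rule measurable_completion) simp
      next
        show "AE x in lebesgue. (norm (f x))\<^sup>2 = p x" using ff by eventually_elim (simp add: p_def)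
      qed
      then show ?thesis by (subst (asm) integrable_completion) auto
    qed
    have q: "integrable lborel q"
    proof -
      have "integrable lebesgue q"
      proof (rule integrable_cong_AE_imp[OF integrable_norm[OF gi]])
        show "q \<in> borel_measurable lebesgue" by (rule measurable_completion) simp
      next
        show "AE x in lebesgue. norm (g x) = q x" using gg by eventually_elim (simp add: q_def)
      qed
      then show ?thesis by (subst (asm) integrable_completion) auto
    qed
    have hyp: "ennreal (norm (\<integral>y. cis (2 * pi * (L t \<bullet> y)) * of_real (p y) \<partial>lborel))
                 \<le> (\<integral>\<^sup>+w. ennreal (q (w - t)) * ennreal (q w) \<partial>lborel)" for t
    proof -
      define R where "R = schroedinger_rep (frequency (L t)) 0 f"
      have [measurable]: "(\<lambda>y. cis (2 * pi * (L t \<bullet> y))) \<in> borel_measurable borel"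
        by (intro borel_measurable_continuous_onI continuous_intros)
      have R: "R \<in> L2" unfolding R_def by (rule schroedinger_rep_L2[OF f])
      have "(\<integral>y. cis (2 * pi * (L t \<bullet> y)) * of_real (p y) \<partial>lborel)
        = (\<integral>y. cis (2 * pi * (L t \<bullet> y)) * of_real (p y) \<partial>lebesgue)"
        by (rule integral_completion[symmetric]) measurable
      also have "\<dots> = L2_inner R f"
        unfolding L2_inner_def
      proof (rule integral_cong_AE)
        show "AE y in lebesgue. cis (2 * pi * (L t \<bullet> y)) * of_real (p y) = R y * cnj (f y)"
          using ff by eventually_elim
            (simp add: R_def schroedinger_rep_frequency p_def mult.assoc complex_norm_square del: of_real_power)
        show "(\<lambda>y. R y * cnj (f y)) \<in> borel_measurable lebesgue"
          using L2_inner_integrable[OF R f] by auto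
        show "(\<lambda>y. cis (2 * pi * (L t \<bullet> y)) * of_real (p y)) \<in> borel_measurable lebesgue"
          by (rule measurable_completion) measurable
      qed
      also have "\<dots> = L2_inner (T R) (T f)" using T R f by (simp add: unitary_L2_def)
      finally have "ennreal (norm (\<integral>y. cis (2 * pi * (L t \<bullet> y)) * of_real (p y) \<partial>lborel))
         \<le> (\<integral>\<^sup>+w. ennreal (norm (T R w * cnj (T f w))) \<partial>lebesgue)"
        unfolding L2_inner_def by (simp only: ennreal_norm_integral_le)
      also have "\<dots> = (\<integral>\<^sup>+w. ennreal (q (w - t)) * ennreal (q w) \<partial>lebesgue)"
      proof (rule nn_integral_cong_AE)
        have "position (S *v frequency (L t)) = t"
          unfolding S position_block_mat_frequency BL ..
        then have nS: "norm (schroedinger_rep (S *v frequency (L t)) 0 (T f) w) = norm (T f (w - t))" for w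
          by (simp add: norm_schroedinger_rep)
        show "AE w in lebesgue. ennreal (norm (T R w * cnj (T f w))) = ennreal (q (w - t)) * ennreal (q w)"
          using metaplectic_intertwines[OF m f, of "frequency (L t)" 0] Tg AE_lebesgue_translate[OF Tg, of t]
        proof eventually_elim
          case (elim w)
          have "norm (T R w) = q (w - t)" using elim(1,3) nS[of w] by (simp add: R_def q_def)
          moreover have "norm (cnj (T f w)) = q w" using elim(2) by (simp add: q_def)
          ultimately show ?case by (simp only: norm_mult ennreal_mult q_def norm_ge_zero)
        qed
      qed
      also have "\<dots> = (\<integral>\<^sup>+w. ennreal (q (w - t)) * ennreal (q w) \<partial>lborel)"
        by (rule nn_integral_completion)
      finally show ?thesis .
    qed
    have "AE x in lborel. p x \<le> c * (\<integral>x. q x \<partial>lborel)\<^sup>2"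
    proof (rule AE_le_of_ball_average[OF p])
      show "0 \<le> p x" for x by (simp add: p_def)
      show "0 \<le> c * (\<integral>x. q x \<partial>lborel)\<^sup>2" using c by simp
      show "(\<integral>\<^sup>+y. ennreal (p y) * indicator (ball x r) y \<partial>lborel)
          \<le> ennreal (c * (\<integral>x. q x \<partial>lborel)\<^sup>2) * emeasure lborel (ball x r)" if "0 < r" for x r
        unfolding c_def
        by (rule ball_average_bound[OF p _ q _ L \<kappa>(2,1) hyp that]) (auto simp: p_def q_def)
    qed
    moreover have "(\<integral>x. q x \<partial>lborel) = (\<integral>x. norm (g x) \<partial>lebesgue)"
    proof -
      have "(\<integral>x. q x \<partial>lborel) = (\<integral>x. q x \<partial>lebesgue)"
        by (rule integral_completion[symmetric]) simp
      also have "\<dots> = (\<integral>x. norm (g x) \<partial>lebesgue)"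
        using gg gi by (intro integral_cong_AE) (auto simp: q_def measurable_completion elim: eventually_mono)
      finally show ?thesis .
    qed
    ultimately have "AE x in lebesgue. p x \<le> c * (\<integral>x. norm (g x) \<partial>lebesgue)\<^sup>2"
      by (simp add: AE_completion_iff)
    then show "AE x in lebesgue. (norm (f x))\<^sup>2 \<le> c * (\<integral>x. norm (g x) \<partial>lebesgue)\<^sup>2"
      using ff by eventually_elim (simp add: p_def)
  qed
qed

text \<open>Cauchy-Schwarz on \<open>F\<close>, obtained from 2 * s * |g| <= s^2 + |g|^2: after
  integration the free parameter \<open>s\<close> is optimised, and s = 1 already gives
  integrability.\<close>

lemma set_integral_norm_square_le:
  fixes g :: "'a::euclidean_space \<Rightarrow> complex"
  assumes g: "g \<in> L2" and F: "F \<in> lmeasurable"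
  shows "integrable lebesgue (\<lambda>x. indicator F x * g x)"
    and "(\<integral>x. norm (indicator F x * g x) \<partial>lebesgue)\<^sup>2 \<le> measure lebesgue F * (\<integral>x. (norm (g x))\<^sup>2 \<partial>lebesgue)"
proof -
  have Fi: "integrable lebesgue (indicator F :: 'a \<Rightarrow> real)"
    using F by (simp add: lmeasurable_iff_integrable)
  have gi: "integrable lebesgue (\<lambda>x. (norm (g x))\<^sup>2)" by (rule L2_integrable[OF g])
  have bd: "norm (indicator F x * g x) \<le> (s * indicator F x + (norm (g x))\<^sup>2 / s) / 2" if "s > 0" for s :: real and x
  proof -
    have "0 \<le> (s - norm (g x))\<^sup>2" by simp
    then have "2 * s * norm (g x) \<le> s\<^sup>2 + (norm (g x))\<^sup>2" by (simp add: power2_diff)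
    then have "norm (g x) \<le> (s + (norm (g x))\<^sup>2 / s) / 2"
      using that by (simp add: field_simps power2_eq_square)
    then show ?thesis using that by (simp add: indicator_def)
  qed
  show I: "integrable lebesgue (\<lambda>x. indicator F x * g x)"
  proof (rule Bochner_Integration.integrable_bound)
    show "integrable lebesgue (\<lambda>x. (1 * indicator F x + (norm (g x))\<^sup>2 / 1) / (2::real))"
      using Fi gi by auto
    show "(\<lambda>x. indicator F x * g x) \<in> borel_measurable lebesgue"
      by (rule L2_measurable[OF L2_indicator[OF g fmeasurableD[OF F]]])
    show "AE x in lebesgue. norm (indicator F x * g x) \<le> norm ((1 * indicator F x + (norm (g x))\<^sup>2 / 1) / (2::real))"
      using bd[of 1] by (intro always_eventually allI order_trans[OF bd[of 1]]) auto
  qed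
  define a where "a = measure lebesgue F"
  define b where "b = (\<integral>x. (norm (g x))\<^sup>2 \<partial>lebesgue)"
  define J where "J = (\<integral>x. norm (indicator F x * g x) \<partial>lebesgue)"
  have a: "a \<ge> 0" and b: "b \<ge> 0" and J: "J \<ge> 0" by (simp_all add: a_def b_def J_def)
  have le: "2 * J \<le> s * a + b / s" if "s > 0" for s
  proof -
    have "J \<le> (\<integral>x. (s * indicator F x + (norm (g x))\<^sup>2 / s) / 2 \<partial>lebesgue)"
      unfolding J_def by (rule integral_mono) (use I Fi gi bd[OF that] in auto)
    also have "\<dots> = (s * a + b / s) / 2"
      using Fi gi F by (simp add: a_def b_def fmeasurableD)
    finally show ?thesis by simp
  qed
  have "J\<^sup>2 \<le> a * b"
  proof (cases "J = 0")
    case True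
    then show ?thesis using a b by simp
  next
    case False
    then have J0: "J > 0" using J by simp
    have b0: "b > 0"
    proof (rule ccontr)
      \<comment> \<open>With b = 0 the choice s = J / (a + 1) would give 2 * J <= J.\<close>
      assume "\<not> b > 0"
      then have "2 * J \<le> J / (a + 1) * a" using le[of "J / (a + 1)"] J0 a b by simp
      also have "\<dots> \<le> J" using J0 a by (simp add: field_simps)
      finally show False using J0 by simp
    qed
    \<comment> \<open>At s = b / J the second term equals \<open>J\<close> and leaves J <= a * b /
      J.\<close>
    have "2 * J \<le> b / J * a + b / (b / J)" by (rule le) (use b0 J0 in simp)
    then have "J \<le> b * a / J" using b0 J0 by simp
    then show ?thesis using J0 by (simp add: field_simps power2_eq_square)
  qed
  then show "(\<integral>x. norm (indicator F x * g x) \<partial>lebesgue)\<^sup>2 \<le> measure lebesgue F * (\<integral>x. (norm (g x))\<^sup>2 \<partial>lebesgue)"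
    by (simp add: a_def b_def J_def)
qed

section \<open>Concentrated functions\<close>

lemma integral_indicator_norm_square:
  assumes "f \<in> L2" "A \<in> sets lebesgue"
  shows "integrable lebesgue (\<lambda>x. indicator A x * (norm (f x))\<^sup>2)"
    and "(\<integral>x. indicator A x * (norm (f x))\<^sup>2 \<partial>lebesgue) \<le> (\<integral>x. (norm (f x))\<^sup>2 \<partial>lebesgue)"
    and "(\<integral>x. (norm (f x))\<^sup>2 \<partial>lebesgue) = (\<integral>x. indicator A x * (norm (f x))\<^sup>2 \<partial>lebesgue) + (\<integral>x. indicator (- A) x * (norm (f x))\<^sup>2 \<partial>lebesgue)"
proof -
  have i: "integrable lebesgue (\<lambda>x. indicator B x * (norm (f x))\<^sup>2)" if "B \<in> sets lebesgue" for B
    using integrable_real_mult_indicator[OF that L2_integrable[OF assms(1)]] by (simp add: mult.commute)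
  show "integrable lebesgue (\<lambda>x. indicator A x * (norm (f x))\<^sup>2)" by (rule i[OF assms(2)])
  show "(\<integral>x. indicator A x * (norm (f x))\<^sup>2 \<partial>lebesgue) \<le> (\<integral>x. (norm (f x))\<^sup>2 \<partial>lebesgue)"
    by (rule integral_mono[OF i[OF assms(2)] L2_integrable[OF assms(1)]]) (simp add: indicator_def)
  have nA: "- A \<in> sets lebesgue" using assms(2) by (simp add: Compl_in_sets_lebesgue)
  show "(\<integral>x. (norm (f x))\<^sup>2 \<partial>lebesgue) = (\<integral>x. indicator A x * (norm (f x))\<^sup>2 \<partial>lebesgue) + (\<integral>x. indicator (- A) x * (norm (f x))\<^sup>2 \<partial>lebesgue)"
    unfolding Bochner_Integration.integral_add[OF i[OF assms(2)] i[OF nA], symmetric]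
    by (intro Bochner_Integration.integral_cong) (auto simp: indicator_def)
qed

text \<open>\<open>v\<close> is a preimage of the cut-off function. By isometry the passage from
  \<open>u\<close> to \<open>v\<close> costs exactly the mass of \<open>T u\<close> outside
  \<open>F\<close>; in return the dispersive bound applies to \<open>v\<close>, whose image lives on
  \<open>F\<close>.\<close>

lemma unitary_cutoff:
  assumes T: "unitary_L2 T" and u: "u \<in> L2" and F: "F \<in> sets lebesgue"
  obtains v where "v \<in> L2" "AE x in lebesgue. T v x = indicator F x * T u x"
    "(\<integral>x. (norm (u x - v x))\<^sup>2 \<partial>lebesgue) = (\<integral>x. indicator (- F) x * (norm (T u x))\<^sup>2 \<partial>lebesgue)"
proof -
  have "(\<lambda>x. indicator F x * T u x) \<in> L2"
    by (rule L2_indicator[OF unitary_L2_mem[OF T u] F])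
  then obtain v where v: "v \<in> L2" "L2_eq (T v) (\<lambda>x. indicator F x * T u x)"
    using T unfolding unitary_L2_def by blast
  have ae: "AE x in lebesgue. T v x = indicator F x * T u x" using v(2) by (simp add: L2_eq_def)
  have "(\<integral>x. (norm (u x - v x))\<^sup>2 \<partial>lebesgue) = (\<integral>x. (norm (T u x - T v x))\<^sup>2 \<partial>lebesgue)"
    by (rule unitary_diff_norm_square[OF T u v(1)])
  also have "\<dots> = (\<integral>x. indicator (- F) x * (norm (T u x))\<^sup>2 \<partial>lebesgue)"
  proof (rule integral_cong_AE)
    show "AE x in lebesgue. (norm (T u x - T v x))\<^sup>2 = indicator (- F) x * (norm (T u x))\<^sup>2"
      using ae by eventually_elim (simp add: indicator_def)
    show "(\<lambda>x. (norm (T u x - T v x))\<^sup>2) \<in> borel_measurable lebesgue"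
      using L2_integrable[OF L2_diff[OF unitary_L2_mem[OF T u] unitary_L2_mem[OF T v(1)]]] by auto
    have "- F \<in> sets lebesgue" using F by (simp add: Compl_in_sets_lebesgue)
    then show "(\<lambda>x. indicator (- F) x * (norm (T u x))\<^sup>2) \<in> borel_measurable lebesgue"
      by (intro borel_measurable_integrable integral_indicator_norm_square(1) unitary_L2_mem[OF T u])
  qed
  finally show thesis using v(1) ae that by blast
qed

lemma L2_norm_square_sum_orthonormal:
  fixes u :: "nat \<Rightarrow> 'a::euclidean_space \<Rightarrow> complex"
  assumes u: "\<And>k. k < N \<Longrightarrow> u k \<in> L2"
    and on: "\<And>i j. i < N \<Longrightarrow> j < N \<Longrightarrow> L2_inner (u i) (u j) = (if i = j then 1 else 0)"
  shows "(\<integral>x. (norm (\<Sum>k<N. a k * u k x))\<^sup>2 \<partial>lebesgue) = (\<Sum>k<N. (norm (a k))\<^sup>2)"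
proof -
  have "complex_of_real (\<integral>x. (norm (\<Sum>k<N. a k * u k x))\<^sup>2 \<partial>lebesgue)
    = (\<integral>x. (\<Sum>k<N. a k * u k x) * cnj (\<Sum>k<N. a k * u k x) \<partial>lebesgue)"
    unfolding L2_inner_self[symmetric] L2_inner_def ..
  also have "\<dots> = (\<integral>x. (\<Sum>i<N. \<Sum>j<N. (a i * cnj (a j)) * (u i x * cnj (u j x))) \<partial>lebesgue)"
    by (simp add: sum_product mult_ac)
  also have "\<dots> = (\<Sum>i<N. \<Sum>j<N. (a i * cnj (a j)) * L2_inner (u i) (u j))"
  proof -
    have int: "integrable lebesgue (\<lambda>x. (a i * cnj (a j)) * (u i x * cnj (u j x)))" if "i < N" "j < N" for i j
      by (intro integrable_mult_right L2_inner_integrable u that)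
    have "(\<integral>x. (\<Sum>i<N. \<Sum>j<N. (a i * cnj (a j)) * (u i x * cnj (u j x))) \<partial>lebesgue)
      = (\<Sum>i<N. \<integral>x. (\<Sum>j<N. (a i * cnj (a j)) * (u i x * cnj (u j x))) \<partial>lebesgue)"
      by (rule Bochner_Integration.integral_sum) (intro Bochner_Integration.integrable_sum int, auto)
    also have "\<dots> = (\<Sum>i<N. \<Sum>j<N. \<integral>x. (a i * cnj (a j)) * (u i x * cnj (u j x)) \<partial>lebesgue)"
      by (intro sum.cong[OF refl] Bochner_Integration.integral_sum) (intro int, auto)
    finally show ?thesis unfolding L2_inner_def by (simp only: integral_mult_right_zero)
  qed
  also have "\<dots> = (\<Sum>i<N. \<Sum>j<N. if i = j then a i * cnj (a j) else 0)"
    by (intro sum.cong refl) (simp add: on)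
  also have "\<dots> = complex_of_real (\<Sum>k<N. (norm (a k))\<^sup>2)"
  proof -
    have "(\<Sum>j<N. if i = j then a i * cnj (a j) else 0) = a i * cnj (a i)" if "i < N" for i
      using that by (simp add: sum.delta')
    then show ?thesis by (simp add: complex_norm_square del: of_real_power)
  qed
  finally show ?thesis by (simp only: of_real_eq_iff)
qed

text \<open>On a set of finite measure the L^2 norm controls the L^1 norm, so the dispersive bound
  turns L^2 information about the image into a pointwise bound.\<close>

lemma dispersive_cutoff_bound:
  assumes d: "dispersive c T" and v: "v \<in> L2" and g: "g \<in> L2" and F: "F \<in> lmeasurable"
    and eq: "AE x in lebesgue. T v x = indicator F x * g x"
  shows "AE x in lebesgue. (norm (v x))\<^sup>2 \<le> c * measure lebesgue F * (\<integral>x. (norm (g x))\<^sup>2 \<partial>lebesgue)"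
proof -
  have c: "c \<ge> 0" using d by (simp add: dispersive_def)
  have "AE x in lebesgue. (norm (v x))\<^sup>2 \<le> c * (\<integral>x. norm (indicator F x * g x) \<partial>lebesgue)\<^sup>2"
    by (rule d[unfolded dispersive_def L2_eq_def, THEN conjunct2, rule_format, OF v eq
          set_integral_norm_square_le(1)[OF g F]])
  then show ?thesis
  proof eventually_elim
    case (elim x)
    also have "c * (\<integral>x. norm (indicator F x * g x) \<partial>lebesgue)\<^sup>2 \<le> c * (measure lebesgue F * (\<integral>x. (norm (g x))\<^sup>2 \<partial>lebesgue))"
      by (rule mult_left_mono[OF set_integral_norm_square_le(2)[OF g F] c])
    finally show ?case by (simp only: mult.assoc)
  qed
qed

text \<open>In terms of operators, the squared Hilbert-Schmidt norm of 1_E T^(-1) 1_F is at most c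
  |E| |F|, and every member of the family contributes at least 1/4 to it. A kernel is replaced by
  the following: each combination of the cut-off functions \<open>v k\<close> is bounded pointwise
  through the Euclidean norm of its coefficients, which bounds the sum of the squares |v k|^2 by c
  |F|.\<close>

lemma card_concentrated_orthonormal_le:
  fixes T :: "('a::euclidean_space \<Rightarrow> complex) \<Rightarrow> ('a \<Rightarrow> complex)" and u :: "nat \<Rightarrow> 'a \<Rightarrow> complex"
  assumes T: "unitary_L2 T" and d: "dispersive c T"
    and E: "E \<in> lmeasurable" and F: "F \<in> lmeasurable"
    and u: "\<And>k. k < N \<Longrightarrow> u k \<in> L2"
    and on: "\<And>i j. i < N \<Longrightarrow> j < N \<Longrightarrow> L2_inner (u i) (u j) = (if i = j then 1 else 0)"
    and uE: "\<And>k. k < N \<Longrightarrow> (\<integral>x. indicator (- E) x * (norm (u k x))\<^sup>2 \<partial>lebesgue) \<le> 1/6"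
    and uF: "\<And>k. k < N \<Longrightarrow> (\<integral>x. indicator (- F) x * (norm (T (u k) x))\<^sup>2 \<partial>lebesgue) \<le> 1/6"
  shows "real N \<le> 4 * c * measure lebesgue E * measure lebesgue F"
proof -
  have c: "c \<ge> 0" using d by (simp add: dispersive_def)
  have Es: "E \<in> sets lebesgue" and Fs: "F \<in> sets lebesgue" using E F by (auto simp: fmeasurableD)
  have "\<forall>k. \<exists>v. k < N \<longrightarrow> v \<in> L2 \<and> (AE x in lebesgue. T v x = indicator F x * T (u k) x) \<and>
      (\<integral>x. (norm (u k x - v x))\<^sup>2 \<partial>lebesgue) \<le> 1/6"
  proof
    fix k
    show "\<exists>v. k < N \<longrightarrow> v \<in> L2 \<and> (AE x in lebesgue. T v x = indicator F x * T (u k) x) \<and>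
      (\<integral>x. (norm (u k x - v x))\<^sup>2 \<partial>lebesgue) \<le> 1/6"
    proof (cases "k < N")
      case True
      obtain v where "v \<in> L2" "AE x in lebesgue. T v x = indicator F x * T (u k) x"
        "(\<integral>x. (norm (u k x - v x))\<^sup>2 \<partial>lebesgue) = (\<integral>x. indicator (- F) x * (norm (T (u k) x))\<^sup>2 \<partial>lebesgue)"
        using unitary_cutoff[OF T u[OF True] Fs] .
      then show ?thesis using uF[OF True] by (intro exI[of _ v]) simp
    qed simp
  qed
  from choice[OF this] obtain v where v: "\<And>k. k < N \<Longrightarrow> v k \<in> L2"
    "\<And>k. k < N \<Longrightarrow> AE x in lebesgue. T (v k) x = indicator F x * T (u k) x"
    "\<And>k. k < N \<Longrightarrow> (\<integral>x. (norm (u k x - v k x))\<^sup>2 \<partial>lebesgue) \<le> 1/6"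
    by blast
  have vbd: "AE x in lebesgue. (norm (\<Sum>k<N. a k * v k x))\<^sup>2 \<le> c * measure lebesgue F * (\<Sum>k<N. (norm (a k))\<^sup>2)" for a
  proof -
    have V: "(\<lambda>x. \<Sum>k<N. a k * v k x) \<in> L2" and U: "(\<lambda>x. \<Sum>k<N. a k * u k x) \<in> L2"
      using u v by (auto intro!: L2_sum L2_cmult)
    have "AE x in lebesgue. T (\<lambda>x. \<Sum>k<N. a k * v k x) x = (\<Sum>k<N. a k * T (v k) x)"
      by (rule unitary_sum[OF T]) (use v in auto)
    moreover have "AE x in lebesgue. T (\<lambda>x. \<Sum>k<N. a k * u k x) x = (\<Sum>k<N. a k * T (u k) x)"
      by (rule unitary_sum[OF T]) (use u in auto)
    moreover have "AE x in lebesgue. \<forall>k\<in>{..<N}. T (v k) x = indicator F x * T (u k) x"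
      by (rule AE_finite_allI) (use v in auto)
    ultimately have "AE x in lebesgue. T (\<lambda>x. \<Sum>k<N. a k * v k x) x = indicator F x * T (\<lambda>x. \<Sum>k<N. a k * u k x) x"
      by eventually_elim (simp add: sum_distrib_left mult_ac)
    moreover have "(\<integral>x. (norm (\<Sum>k<N. a k * u k x))\<^sup>2 \<partial>lebesgue) = (\<Sum>k<N. (norm (a k))\<^sup>2)"
      by (rule L2_norm_square_sum_orthonormal) (use u on in auto)
    ultimately show ?thesis
      using dispersive_cutoff_bound[OF d V unitary_L2_mem[OF T U] F] unitary_norm_square[OF T U] by simp
  qed
  have sum_bd: "AE x in lebesgue. (\<Sum>k<N. (norm (v k x))\<^sup>2) \<le> c * measure lebesgue F"
    by (rule AE_sum_norm_square_le[OF vbd]) (use c in simp)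
  \<comment> \<open>Of the mass 1 of \<open>u k\<close>, at most 1/6 lies outside \<open>E\<close>.
    Replacing \<open>u k\<close> by \<open>v k\<close> on \<open>E\<close> costs at most 2 * (1/6)
    and a factor 2, by |a + b|^2 <= 2 |a|^2 + 2 |b|^2; this leaves 1 - 1/6 - 1/3 = 1/2.\<close>
  have each: "1/2 \<le> 2 * (\<integral>x. indicator E x * (norm (v k x))\<^sup>2 \<partial>lebesgue)" if k: "k < N" for k
  proof -
    have uk: "u k \<in> L2" and vk: "v k \<in> L2" and dk: "(\<lambda>x. u k x - v k x) \<in> L2"
      using u v k by (auto intro!: L2_diff)
    have "complex_of_real (\<integral>x. (norm (u k x))\<^sup>2 \<partial>lebesgue) = 1"
      using on[OF k k] by (simp add: L2_inner_self)
    then have "1 = (\<integral>x. (norm (u k x))\<^sup>2 \<partial>lebesgue)" by (simp only: of_real_eq_1_iff)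
    also have "\<dots> \<le> (\<integral>x. indicator E x * (norm (u k x))\<^sup>2 \<partial>lebesgue) + 1/6"
      using integral_indicator_norm_square(3)[OF uk Es] uE[OF k] by simp
    also have "(\<integral>x. indicator E x * (norm (u k x))\<^sup>2 \<partial>lebesgue)
      \<le> (\<integral>x. 2 * (indicator E x * (norm (v k x))\<^sup>2) + 2 * (indicator E x * (norm (u k x - v k x))\<^sup>2) \<partial>lebesgue)"
    proof (rule integral_mono)
      show "indicator E x * (norm (u k x))\<^sup>2
        \<le> 2 * (indicator E x * (norm (v k x))\<^sup>2) + 2 * (indicator E x * (norm (u k x - v k x))\<^sup>2)" for x
        using norm_add_square_le[of "v k x" "u k x - v k x"] by (simp add: indicator_def)
    qed (intro Bochner_Integration.integrable_add integrable_mult_right integral_indicator_norm_square(1) uk vk dk Es)+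
    also have "\<dots> = 2 * (\<integral>x. indicator E x * (norm (v k x))\<^sup>2 \<partial>lebesgue) + 2 * (\<integral>x. indicator E x * (norm (u k x - v k x))\<^sup>2 \<partial>lebesgue)"
      using integral_indicator_norm_square(1)[OF vk Es] integral_indicator_norm_square(1)[OF dk Es]
      by (subst Bochner_Integration.integral_add) auto
    also have "(\<integral>x. indicator E x * (norm (u k x - v k x))\<^sup>2 \<partial>lebesgue) \<le> 1/6"
      using integral_indicator_norm_square(2)[OF dk Es] v(3)[OF k] by simp
    finally show ?thesis by simp
  qed
  have "real N * (1/2) = (\<Sum>k<N. 1/2)" by simp
  also have "\<dots> \<le> (\<Sum>k<N. 2 * (\<integral>x. indicator E x * (norm (v k x))\<^sup>2 \<partial>lebesgue))"
    by (intro sum_mono each) simp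
  also have "\<dots> = 2 * (\<integral>x. (\<Sum>k<N. indicator E x * (norm (v k x))\<^sup>2) \<partial>lebesgue)"
    by (subst Bochner_Integration.integral_sum)
       (auto simp: sum_distrib_left intro!: integral_indicator_norm_square(1) v Es)
  also have "(\<integral>x. (\<Sum>k<N. indicator E x * (norm (v k x))\<^sup>2) \<partial>lebesgue) \<le> (\<integral>x. indicator E x * (c * measure lebesgue F) \<partial>lebesgue)"
  proof (rule integral_mono_AE)
    show "integrable lebesgue (\<lambda>x. \<Sum>k<N. indicator E x * (norm (v k x))\<^sup>2)"
      by (intro Bochner_Integration.integrable_sum integral_indicator_norm_square(1) v Es) simp
    show "integrable lebesgue (\<lambda>x. indicator E x * (c * measure lebesgue F))"
      using E by (simp add: lmeasurable_iff_integrable)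
    show "AE x in lebesgue. (\<Sum>k<N. indicator E x * (norm (v k x))\<^sup>2) \<le> indicator E x * (c * measure lebesgue F)"
      using sum_bd by eventually_elim (simp add: indicator_def)
  qed
  also have "\<dots> = measure lebesgue E * (c * measure lebesgue F)" using E by (simp add: fmeasurableD)
  finally show ?thesis by (simp add: mult_ac)
qed

text \<open>Excludes that \<phi> gathers on a small set, later the set where a polynomial in w is
  small. Write \<phi> as \<open>v\<close> plus a remainder, with T v the cut-off of T \<phi> to
  \<open>F\<close>: \<open>v\<close> is bounded pointwise on A \<inter> E, the remainder counts
  twice with mass at most \<epsilon>, and the part outside \<open>E\<close> adds one more
  \<epsilon>.\<close>

lemma concentrated_mass_le:
  fixes T :: "('a::euclidean_space \<Rightarrow> complex) \<Rightarrow> ('a \<Rightarrow> complex)"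
  assumes T: "unitary_L2 T" and d: "dispersive c T"
    and E: "E \<in> lmeasurable" and F: "F \<in> lmeasurable" and A: "A \<in> sets lebesgue"
    and \<phi>: "\<phi> \<in> L2" and n: "(\<integral>x. (norm (\<phi> x))\<^sup>2 \<partial>lebesgue) = 1"
    and \<phi>E: "(\<integral>x. indicator (- E) x * (norm (\<phi> x))\<^sup>2 \<partial>lebesgue) \<le> \<epsilon>"
    and \<phi>F: "(\<integral>x. indicator (- F) x * (norm (T \<phi> x))\<^sup>2 \<partial>lebesgue) \<le> \<epsilon>"
  shows "(\<integral>x. indicator A x * (norm (\<phi> x))\<^sup>2 \<partial>lebesgue) \<le> 3 * \<epsilon> + 2 * (c * measure lebesgue F * measure lebesgue (A \<inter> E))"
proof -
  have Es: "E \<in> sets lebesgue" and Fs: "F \<in> sets lebesgue" using E F by (auto simp: fmeasurableD)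
  have nEs: "- E \<in> sets lebesgue" using Es by (simp add: Compl_in_sets_lebesgue)
  have AE: "A \<inter> E \<in> lmeasurable" using E A by (metis fmeasurable_Int_fmeasurable inf_commute)
  have AEs: "A \<inter> E \<in> sets lebesgue" using AE by (rule fmeasurableD)
  obtain v where v: "v \<in> L2" "AE x in lebesgue. T v x = indicator F x * T \<phi> x"
    "(\<integral>x. (norm (\<phi> x - v x))\<^sup>2 \<partial>lebesgue) = (\<integral>x. indicator (- F) x * (norm (T \<phi> x))\<^sup>2 \<partial>lebesgue)"
    using unitary_cutoff[OF T \<phi> Fs] .
  have vbd: "AE x in lebesgue. (norm (v x))\<^sup>2 \<le> c * measure lebesgue F"
    using dispersive_cutoff_bound[OF d v(1) unitary_L2_mem[OF T \<phi>] F v(2)] unitary_norm_square[OF T \<phi>] n by simp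
  have dL: "(\<lambda>x. \<phi> x - v x) \<in> L2" using \<phi> v by (intro L2_diff)
  have "(\<integral>x. indicator A x * (norm (\<phi> x))\<^sup>2 \<partial>lebesgue)
    \<le> (\<integral>x. indicator (- E) x * (norm (\<phi> x))\<^sup>2 + (2 * (indicator (A \<inter> E) x * (c * measure lebesgue F)) + 2 * (norm (\<phi> x - v x))\<^sup>2) \<partial>lebesgue)"
  proof (rule integral_mono_AE)
    show "integrable lebesgue (\<lambda>x. indicator A x * (norm (\<phi> x))\<^sup>2)"
      by (rule integral_indicator_norm_square(1)[OF \<phi> A])
    show "integrable lebesgue (\<lambda>x. indicator (- E) x * (norm (\<phi> x))\<^sup>2 + (2 * (indicator (A \<inter> E) x * (c * measure lebesgue F)) + 2 * (norm (\<phi> x - v x))\<^sup>2))"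
      using AE integral_indicator_norm_square(1)[OF \<phi> nEs] L2_integrable[OF dL]
      by (intro Bochner_Integration.integrable_add integrable_mult_right) (auto simp: lmeasurable_iff_integrable)
    show "AE x in lebesgue. indicator A x * (norm (\<phi> x))\<^sup>2
      \<le> indicator (- E) x * (norm (\<phi> x))\<^sup>2 + (2 * (indicator (A \<inter> E) x * (c * measure lebesgue F)) + 2 * (norm (\<phi> x - v x))\<^sup>2)"
      using vbd
    proof eventually_elim
      case (elim x)
      then show ?case
        using norm_add_square_le[of "v x" "\<phi> x - v x"] by (auto simp: indicator_def)
    qed
  qed
  also have "\<dots> = (\<integral>x. indicator (- E) x * (norm (\<phi> x))\<^sup>2 \<partial>lebesgue) + (2 * (measure lebesgue (A \<inter> E) * (c * measure lebesgue F)) + 2 * (\<integral>x. (norm (\<phi> x - v x))\<^sup>2 \<partial>lebesgue))"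
  proof -
    have i1: "integrable lebesgue (\<lambda>x. 2 * (indicator (A \<inter> E) x * (c * measure lebesgue F)))"
      using AE by (simp add: lmeasurable_iff_integrable)
    have i2: "integrable lebesgue (\<lambda>x. 2 * (norm (\<phi> x - v x))\<^sup>2)" using L2_integrable[OF dL] by simp
    show ?thesis
      by (simp only: Bochner_Integration.integral_add[OF integral_indicator_norm_square(1)[OF \<phi> nEs] Bochner_Integration.integrable_add[OF i1 i2]]
          Bochner_Integration.integral_add[OF i1 i2]) (use AEs in simp)
  qed
  also have "\<dots> \<le> \<epsilon> + (2 * (measure lebesgue (A \<inter> E) * (c * measure lebesgue F)) + 2 * \<epsilon>)"
    using \<phi>E \<phi>F v(3) by linarith
  finally show ?thesis by (simp add: mult_ac)
qed

section \<open>Estimates for translates and polynomial multiples\<close>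

lemma L2_norm_square_translate:
  assumes f: "f \<in> L2"
  shows "(\<integral>x. (norm (f (x - t)))\<^sup>2 \<partial>lebesgue) = (\<integral>x. (norm (f x))\<^sup>2 \<partial>lebesgue)"
proof -
  have "(\<integral>\<^sup>+x. ennreal ((norm (f (x - t)))\<^sup>2) \<partial>lebesgue) = (\<integral>\<^sup>+x. ennreal ((norm (f x))\<^sup>2) \<partial>lebesgue)"
    by (rule nn_integral_lebesgue_translate[OF L2_measurable[OF f]]) measurable
  then show ?thesis
    using L2_integrable[OF f] L2_integrable[OF L2_translate[OF f, of t]]
    by (simp add: integral_eq_nn_integral borel_measurable_integrable)
qed

lemma norm_poly_le:
  fixes p :: "complex poly"
  assumes z: "norm z = 1" and K: "\<And>j. norm (coeff p j) \<le> K" and N: "degree p < N"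
  shows "norm (poly p z) \<le> N * K"
proof -
  have K0: "0 \<le> K" using K[of 0] norm_ge_zero order_trans by blast
  have "norm (poly p z) \<le> (\<Sum>i\<le>degree p. norm (coeff p i * z ^ i))"
    unfolding poly_altdef by (rule norm_sum)
  also have "\<dots> \<le> (\<Sum>i\<le>degree p. K)"
    by (intro sum_mono) (simp add: norm_mult norm_power z K)
  also have "\<dots> = real (Suc (degree p)) * K" by simp
  also have "\<dots> \<le> N * K" using N K0 by (intro mult_right_mono) auto
  finally show ?thesis .
qed

lemma poly_eq_sum_lessThan:
  fixes p :: "'a::comm_semiring_1 poly"
  assumes "degree p < N"
  shows "poly p z = (\<Sum>j<N. coeff p j * z ^ j)"
  unfolding poly_altdef
  by (rule sum.mono_neutral_left) (use assms in \<open>auto simp: coeff_eq_0\<close>)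

lemma norm_sum_mult_square_le:
  fixes a x :: "nat \<Rightarrow> complex"
  assumes "\<And>j. norm (a j) \<le> K"
  shows "(norm (\<Sum>j<N. a j * x j))\<^sup>2 \<le> N * K\<^sup>2 * (\<Sum>j<N. (norm (x j))\<^sup>2)"
proof -
  have "norm (\<Sum>j<N. a j * x j) \<le> (\<Sum>j<N. K * norm (x j))"
    by (rule sum_norm_le) (simp add: norm_mult mult_right_mono assms)
  then have "(norm (\<Sum>j<N. a j * x j))\<^sup>2 \<le> (\<Sum>j<N. K * norm (x j))\<^sup>2"
    by (rule power_mono) simp
  also have "\<dots> \<le> (\<Sum>j<N. K\<^sup>2) * (\<Sum>j<N. (norm (x j))\<^sup>2)"
    by (rule Cauchy_Schwarz_ineq_sum)
  finally show ?thesis by simp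
qed

text \<open>The uniform form for unit vectors, from which the theorem follows by scaling. Every
  constant up to \<epsilon> is fixed before \<phi> enters.\<close>

lemma no_concentration:
  fixes S :: "real ^ ('n::finite + 'n) ^ ('n + 'n)"
    and T :: "(real ^ 'n \<Rightarrow> complex) \<Rightarrow> (real ^ 'n \<Rightarrow> complex)"
  assumes free: "free_matrix S" and m: "metaplectic S T"
    and E: "E \<in> lmeasurable" and F: "F \<in> lmeasurable"
  shows "\<exists>\<epsilon>>0. \<forall>\<phi>\<in>L2. (\<integral>x. (norm (\<phi> x))\<^sup>2 \<partial>lebesgue) = 1 \<longrightarrow>
    \<epsilon> < (\<integral>x. indicator (- E) x * (norm (\<phi> x))\<^sup>2 \<partial>lebesgue) \<or>
    \<epsilon> < (\<integral>x. indicator (- F) x * (norm (T \<phi> x))\<^sup>2 \<partial>lebesgue)"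
proof -
  have T: "unitary_L2 T" using m by (simp add: metaplectic_def)
  have Es: "E \<in> sets lebesgue" and Fs: "F \<in> sets lebesgue" using E F by (auto simp: fmeasurableD)
  have nEs: "- E \<in> sets lebesgue" and nFs: "- F \<in> sets lebesgue"
    using Es Fs by (auto simp: Compl_in_sets_lebesgue)
  obtain c where d: "dispersive c T" using dispersive_estimate[OF m free] by blast
  then have c: "c \<ge> 0" by (simp add: dispersive_def)
  obtain A B C D where S: "S = block_mat A B C D"
    using free by (auto simp: free_matrix_def)
  define a where "a = measure lebesgue E"
  define b where "b = measure lebesgue F"
  have a: "a \<ge> 0" and b: "b \<ge> 0" by (simp_all add: a_def b_def)
  \<comment> \<open>One more than \<open>card_concentrated_orthonormal_le\<close> can allow for
    \<open>E\<close> and a set of measure at most b + 1, the size of the union of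
    translates.\<close>
  obtain N where N: "4 * c * a * (b + 1) < real N" using reals_Archimedean2 by blast
  obtain \<delta> where \<delta>: "\<delta> > 0" "\<And>t. norm t < \<delta> \<Longrightarrow> (\<Union>j<N. (+) (real j *\<^sub>R t) ` F) \<in> lmeasurable"
    "\<And>t. norm t < \<delta> \<Longrightarrow> measure lebesgue (\<Union>j<N. (+) (real j *\<^sub>R t) ` F) \<le> b + 1"
    using measure_union_translates[OF F, of N] unfolding b_def by blast
  define h0 where "h0 = (vec 1 :: real ^ 'n)"
  have h0: "h0 \<noteq> 0" by (simp add: h0_def vec_eq_iff)
  define l where "l = norm (B *v h0)"
  have l: "l \<ge> 0" by (simp add: l_def)
  \<comment> \<open>Shortens the direction \<open>h0\<close> until its image under the block B is
    shorter than \<delta>; l + 1 keeps the quotient meaningful for any value of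
    \<open>l\<close>.\<close>
  define s where "s = \<delta> / (2 * (l + 1))"
  have s: "s > 0" using \<delta>(1) l by (simp add: s_def)
  define \<theta> where "\<theta> = s *\<^sub>R h0"
  define \<beta> where "\<beta> = B *v \<theta>"
  have \<beta>: "norm \<beta> < \<delta>"
  proof -
    have "norm \<beta> = s * l" using s by (simp add: \<beta>_def \<theta>_def l_def matrix_vector_mult_scaleR)
    also have "\<dots> < s * (2 * (l + 1))" using s l by (intro mult_strict_left_mono) auto
    also have "\<dots> = \<delta>" using l by (simp add: s_def)
    finally show ?thesis .
  qed
  define F' where "F' = (\<Union>j<N. (+) (real j *\<^sub>R \<beta>) ` F)"
  have F': "F' \<in> lmeasurable" "measure lebesgue F' \<le> b + 1" using \<delta>(2,3)[OF \<beta>] by (simp_all add: F'_def)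
  have F's: "- F' \<in> sets lebesgue" using F'(1) by (simp add: Compl_in_sets_lebesgue fmeasurableD)
  define h where "h = (2 * pi) *\<^sub>R \<theta>"
  have h: "h \<noteq> 0" using h0 s by (simp add: h_def \<theta>_def)
  define w where "w y = cis (h \<bullet> y)" for y
  have nw: "norm (w y) = 1" for y by (simp add: w_def)
  \<comment> \<open>Ensures 2 * c * b * \<kappa> <= 1/4. Together with 3 * \<epsilon> <= 1/4 this
    lets \<phi> have at most half its mass on a set that meets \<open>E\<close> in measure at most
    \<kappa>.\<close>
  define \<kappa> where "\<kappa> = 1 / (8 * (c * b + 1))"
  have cb: "c * b \<ge> 0" using c b by simp
  then have \<kappa>: "\<kappa> > 0" by (simp add: \<kappa>_def)
  have "\<forall>k. \<exists>\<eta>>0. \<forall>Q. lead_coeff Q = 1 \<and> degree Q = k \<longrightarrow>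
    measure lebesgue {y \<in> E. norm (poly Q (w y)) < \<eta>} < \<kappa>"
    unfolding w_def using measure_poly_cis_small[OF E h \<kappa>] by blast
  from choice[OF this] obtain \<eta> where \<eta>: "\<And>k. \<eta> k > 0"
    "\<And>k Q. lead_coeff Q = 1 \<Longrightarrow> degree Q = k \<Longrightarrow> measure lebesgue {y \<in> E. norm (poly Q (w y)) < \<eta> k} < \<kappa>"
    by blast
  \<comment> \<open>A single threshold for monic polynomials of all degrees below
    \<open>N\<close>.\<close>
  define \<eta>' where "\<eta>' = Min (\<eta> ` {..N})"
  have \<eta>': "\<eta>' > 0" "\<And>k. k < N \<Longrightarrow> \<eta>' \<le> \<eta> k"
    using \<eta>(1) by (auto simp: \<eta>'_def)
  \<comment> \<open>Half of the mass of \<phi> will lie where |Q(w)| >= \<eta>', so this is a lower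
    bound for the squared norm of Q(w) \<phi>, as Gram-Schmidt requires.\<close>
  have "0 < \<eta>'\<^sup>2 / 2" using \<eta>' by simp
  from gram_schmidt_poly[OF this, of N] obtain K where K: "K > 0" and GS: "\<forall>B :: complex poly \<Rightarrow> complex poly \<Rightarrow> complex.
    (\<forall>p q r c. B (smult c p + q) r = c * B p r + B q r) \<longrightarrow> (\<forall>p q. B q p = cnj (B p q)) \<longrightarrow>
    (\<forall>k. B (monom 1 k) (monom 1 k) = 1) \<longrightarrow>
    (\<forall>Q. lead_coeff Q = 1 \<and> degree Q < N \<longrightarrow> \<eta>'\<^sup>2 / 2 \<le> Re (B Q Q)) \<longrightarrow>
    (\<exists>P. \<forall>k<N. degree (P k) \<le> k \<and> (\<forall>j. norm (coeff (P k) j) \<le> K) \<and>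
        (\<forall>i<N. B (P k) (P i) = (if k = i then 1 else 0)))"
    by (elim exE conjE)
  \<comment> \<open>The first bound gives 3 * \<epsilon> <= 1/4. The second absorbs the factor (N *
    K)^2 by which the mass outside the sets can grow from \<phi> to the members of the family, whose
    tolerance is 1/6.\<close>
  define \<epsilon> where "\<epsilon> = min (1/12) (1 / (6 * ((N * K)\<^sup>2 + 1)))"
  have NK: "(N * K)\<^sup>2 + 1 > 0" using zero_le_power2[of "N * K"] by linarith
  then have \<epsilon>: "\<epsilon> > 0" by (simp add: \<epsilon>_def)
  have \<epsilon>12: "\<epsilon> \<le> 1/12" by (simp add: \<epsilon>_def)
  have \<epsilon>6: "(N * K)\<^sup>2 * \<epsilon> \<le> 1/6"
  proof -
    have "(N * K)\<^sup>2 * \<epsilon> \<le> ((N * K)\<^sup>2 + 1) * \<epsilon>" using \<epsilon> by (intro mult_right_mono) auto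
    also have "\<dots> \<le> ((N * K)\<^sup>2 + 1) * (1 / (6 * ((N * K)\<^sup>2 + 1)))"
      using NK by (intro mult_left_mono) (auto simp: \<epsilon>_def)
    also have "\<dots> = 1/6" using NK by simp
    finally show ?thesis .
  qed
  show ?thesis
  proof (intro exI[of _ \<epsilon>] conjI ballI impI \<epsilon>)
    fix \<phi> :: "real ^ 'n \<Rightarrow> complex"
    assume \<phi>: "\<phi> \<in> L2" and n: "(\<integral>x. (norm (\<phi> x))\<^sup>2 \<partial>lebesgue) = 1"
    show "\<epsilon> < (\<integral>x. indicator (- E) x * (norm (\<phi> x))\<^sup>2 \<partial>lebesgue) \<or>
      \<epsilon> < (\<integral>x. indicator (- F) x * (norm (T \<phi> x))\<^sup>2 \<partial>lebesgue)"
    proof (rule ccontr)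
      assume "\<not> ?thesis"
      then have \<phi>E: "(\<integral>x. indicator (- E) x * (norm (\<phi> x))\<^sup>2 \<partial>lebesgue) \<le> \<epsilon>"
        and \<phi>F: "(\<integral>x. indicator (- F) x * (norm (T \<phi> x))\<^sup>2 \<partial>lebesgue) \<le> \<epsilon>" by auto
      define g where "g p = (\<lambda>y. poly p (w y) * \<phi> y)" for p
      have pw: "(\<lambda>y. poly p (w y)) \<in> borel_measurable borel" for p
        unfolding w_def by (intro borel_measurable_continuous_onI continuous_intros)
      have g: "g p \<in> L2" for p
      proof -
        obtain M where M: "\<And>j. norm (coeff p j) \<le> M"
        proof -
          have "norm (coeff p j) \<le> (\<Sum>i\<le>degree p. norm (coeff p i))" for j
            by (cases "j \<le> degree p") (auto simp: coeff_eq_0 sum_nonneg intro!: member_le_sum)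
          then show thesis by (rule that)
        qed
        show ?thesis unfolding g_def
          by (rule L2_mult_bounded[OF \<phi>, where c="Suc (degree p) * M"])
             (use pw norm_poly_le[OF nw M lessI] in \<open>auto simp: measurable_completion simp del: of_nat_Suc\<close>)
      qed
      \<comment> \<open>From here on \<open>B\<close> is the Gram form of the polynomial multiples
        of \<phi>; the matrix block of that name survives only inside \<open>S\<close> and \<beta>.
        Since |w| = 1, all monomials have length 1 for it.\<close>
      define B where "B p q = L2_inner (g p) (g q)" for p q
      have lin: "\<forall>p q r c. B (smult c p + q) r = c * B p r + B q r"
      proof (intro allI)
        fix p q r c
        have "B (smult c p + q) r = (\<integral>y. c * (g p y * cnj (g r y)) + g q y * cnj (g r y) \<partial>lebesgue)"
          unfolding B_def L2_inner_def by (intro Bochner_Integration.integral_cong refl) (simp add: g_def algebra_simps)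
        also have "\<dots> = c * B p r + B q r"
          unfolding B_def L2_inner_def
          by (subst Bochner_Integration.integral_add)
             (auto intro!: integrable_mult_right L2_inner_integrable g)
        finally show "B (smult c p + q) r = c * B p r + B q r" .
      qed
      have herm: "\<forall>p q. B q p = cnj (B p q)"
        unfolding B_def L2_inner_def Bochner_Integration.integral_cnj[symmetric] by (simp add: mult.commute)
      have unit: "\<forall>k. B (monom 1 k) (monom 1 k) = 1"
        unfolding B_def L2_inner_self g_def by (simp add: norm_mult norm_power poly_monom nw n)
      have pos: "\<forall>Q. lead_coeff Q = 1 \<and> degree Q < N \<longrightarrow> \<eta>'\<^sup>2 / 2 \<le> Re (B Q Q)"
      proof (intro allI impI)
        fix Q :: "complex poly" assume Q: "lead_coeff Q = 1 \<and> degree Q < N"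
        define A where "A = {y. norm (poly Q (w y)) < \<eta>'}"
        have "open A" unfolding A_def w_def by (intro open_Collect_less continuous_intros)
        then have As: "A \<in> sets lebesgue" and nAs: "- A \<in> sets lebesgue" by (auto simp: Compl_in_sets_lebesgue)
        have open': "open {y. norm (poly Q (w y)) < \<eta> (degree Q)}"
          unfolding w_def by (intro open_Collect_less continuous_intros)
        have lm: "{y \<in> E. norm (poly Q (w y)) < \<eta> (degree Q)} \<in> lmeasurable"
          using fmeasurable_Int_fmeasurable[OF E, of "{y. norm (poly Q (w y)) < \<eta> (degree Q)}"] open'
          by (simp add: Int_def)
        have "measure lebesgue (A \<inter> E) \<le> measure lebesgue {y \<in> E. norm (poly Q (w y)) < \<eta> (degree Q)}"
        proof (rule measure_mono_fmeasurable[OF _ _ lm])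
          show "A \<inter> E \<subseteq> {y \<in> E. norm (poly Q (w y)) < \<eta> (degree Q)}"
            using \<eta>'(2)[of "degree Q"] Q by (auto simp: A_def)
          show "A \<inter> E \<in> sets lebesgue" using As Es by (rule sets.Int)
        qed
        also have "\<dots> < \<kappa>" using \<eta>(2) Q by simp
        finally have AE: "measure lebesgue (A \<inter> E) \<le> \<kappa>" by simp
        have "c * b * measure lebesgue (A \<inter> E) \<le> (c * b + 1) * \<kappa>"
          using AE cb by (intro mult_mono) auto
        also have "\<dots> = 1/8" using cb by (simp add: \<kappa>_def)
        finally have "(\<integral>x. indicator A x * (norm (\<phi> x))\<^sup>2 \<partial>lebesgue) \<le> 1/2"
          using concentrated_mass_le[OF T d E F As \<phi> n \<phi>E \<phi>F] \<epsilon>12 by (simp add: b_def)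
        then have half: "1/2 \<le> (\<integral>x. indicator (- A) x * (norm (\<phi> x))\<^sup>2 \<partial>lebesgue)"
          using integral_indicator_norm_square(3)[OF \<phi> As] n by simp
        have "\<eta>'\<^sup>2 / 2 \<le> \<eta>'\<^sup>2 * (\<integral>x. indicator (- A) x * (norm (\<phi> x))\<^sup>2 \<partial>lebesgue)"
          using mult_left_mono[OF half, of "\<eta>'\<^sup>2"] by simp
        also have "\<dots> = (\<integral>x. \<eta>'\<^sup>2 * (indicator (- A) x * (norm (\<phi> x))\<^sup>2) \<partial>lebesgue)" by simp
        also have "\<dots> \<le> (\<integral>x. (norm (g Q x))\<^sup>2 \<partial>lebesgue)"
        proof (rule integral_mono)
          show "integrable lebesgue (\<lambda>x. \<eta>'\<^sup>2 * (indicator (- A) x * (norm (\<phi> x))\<^sup>2))"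
            by (intro integrable_mult_right integral_indicator_norm_square(1) \<phi> nAs)
          show "integrable lebesgue (\<lambda>x. (norm (g Q x))\<^sup>2)" by (rule L2_integrable[OF g])
          fix x
          show "\<eta>'\<^sup>2 * (indicator (- A) x * (norm (\<phi> x))\<^sup>2) \<le> (norm (g Q x))\<^sup>2"
          proof (cases "x \<in> A")
            case False
            then have "\<eta>'\<^sup>2 \<le> (norm (poly Q (w x)))\<^sup>2"
              using \<eta>'(1) by (intro power_mono) (auto simp: A_def)
            then show ?thesis using False
              by (simp add: g_def norm_mult power_mult_distrib mult_right_mono)
          qed simp
        qed
        finally show "\<eta>'\<^sup>2 / 2 \<le> Re (B Q Q)" by (simp add: B_def L2_inner_self)
      qed
      obtain P where "\<forall>k<N. degree (P k) \<le> k \<and> (\<forall>j. norm (coeff (P k) j) \<le> K) \<and>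
          (\<forall>i<N. B (P k) (P i) = (if k = i then 1 else 0))"
        using GS[THEN spec[of _ B], THEN mp, OF lin, THEN mp, OF herm, THEN mp, OF unit, THEN mp, OF pos] ..
      then have P: "\<And>k. k < N \<Longrightarrow> degree (P k) < N" "\<And>k j. k < N \<Longrightarrow> norm (coeff (P k) j) \<le> K"
          "\<And>k i. k < N \<Longrightarrow> i < N \<Longrightarrow> L2_inner (g (P k)) (g (P i)) = (if k = i then 1 else 0)"
        unfolding B_def by (auto intro: le_less_trans)
      have uE: "(\<integral>x. indicator (- E) x * (norm (g (P k) x))\<^sup>2 \<partial>lebesgue) \<le> 1/6" if k: "k < N" for k
      proof -
        have "(\<integral>x. indicator (- E) x * (norm (g (P k) x))\<^sup>2 \<partial>lebesgue)
          \<le> (\<integral>x. (N * K)\<^sup>2 * (indicator (- E) x * (norm (\<phi> x))\<^sup>2) \<partial>lebesgue)"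
        proof (rule integral_mono)
          show "integrable lebesgue (\<lambda>x. indicator (- E) x * (norm (g (P k) x))\<^sup>2)"
            by (rule integral_indicator_norm_square(1)[OF g nEs])
          show "integrable lebesgue (\<lambda>x. (N * K)\<^sup>2 * (indicator (- E) x * (norm (\<phi> x))\<^sup>2))"
            by (intro integrable_mult_right integral_indicator_norm_square(1) \<phi> nEs)
          fix x
          have "norm (poly (P k) (w x)) \<le> N * K" by (rule norm_poly_le[OF nw P(2,1)[OF k]])
          then have "(norm (poly (P k) (w x)))\<^sup>2 \<le> (N * K)\<^sup>2" by (rule power_mono) simp
          then show "indicator (- E) x * (norm (g (P k) x))\<^sup>2 \<le> (N * K)\<^sup>2 * (indicator (- E) x * (norm (\<phi> x))\<^sup>2)"
            by (simp add: g_def norm_mult power_mult_distrib[of "norm _"] indicator_def mult_right_mono)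
        qed
        also have "\<dots> \<le> (N * K)\<^sup>2 * \<epsilon>"
          using \<phi>E by (simp add: mult_left_mono)
        finally show ?thesis using \<epsilon>6 by linarith
      qed
      have uF: "(\<integral>x. indicator (- F') x * (norm (T (g (P k)) x))\<^sup>2 \<partial>lebesgue) \<le> 1/6" if k: "k < N" for k
      proof -
        \<comment> \<open>These are the functions w^j \<phi>. In modulus, T (f j) is T \<phi>
          translated by j \<beta>.\<close>
        define f where "f j = schroedinger_rep (frequency (real j *\<^sub>R \<theta>)) 0 \<phi>" for j
        have f: "f j \<in> L2" for j unfolding f_def by (rule schroedinger_rep_L2[OF \<phi>])
        have fw: "f j y = w y ^ j * \<phi> y" for j y
        proof -
          have "w y ^ j = cis (2 * pi * ((real j *\<^sub>R \<theta>) \<bullet> y))"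
            unfolding w_def h_def Complex.DeMoivre by (simp add: mult_ac)
          then show ?thesis by (simp add: f_def schroedinger_rep_frequency)
        qed
        have "g (P k) = (\<lambda>y. \<Sum>j<N. coeff (P k) j * f j y)"
          by (simp add: g_def fun_eq_iff poly_eq_sum_lessThan[OF P(1)[OF k]] fw sum_distrib_right mult.assoc)
        moreover have "AE y in lebesgue. T (\<lambda>y. \<Sum>j<N. coeff (P k) j * f j y) y = (\<Sum>j<N. coeff (P k) j * T (f j) y)"
          by (rule unitary_sum[OF T]) (use f in auto)
        ultimately have ae1: "AE y in lebesgue. T (g (P k)) y = (\<Sum>j<N. coeff (P k) j * T (f j) y)" by simp
        have ae2: "AE y in lebesgue. \<forall>j\<in>{..<N}. T (f j) y = schroedinger_rep (S *v frequency (real j *\<^sub>R \<theta>)) 0 (T \<phi>) y"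
          unfolding f_def by (rule AE_finite_allI) (use metaplectic_intertwines[OF m \<phi>] in auto)
        have pos_S: "position (S *v frequency (real j *\<^sub>R \<theta>)) = real j *\<^sub>R \<beta>" for j
          by (simp add: S position_block_mat_frequency \<beta>_def matrix_vector_mult_scaleR)
        \<comment> \<open>Outside \<open>F'\<close> a point shifted back by any j \<beta> lies
          outside \<open>F\<close>, so there T \<phi> may be replaced by its small part
          \<psi>.\<close>
        define \<psi> where "\<psi> x = indicator (- F) x * T \<phi> x" for x
        have \<psi>: "\<psi> \<in> L2" unfolding \<psi>_def by (rule L2_indicator[OF unitary_L2_mem[OF T \<phi>] nFs])
        have \<psi>n: "(\<integral>x. (norm (\<psi> x))\<^sup>2 \<partial>lebesgue) \<le> \<epsilon>"
        proof -
          have "(norm (\<psi> x))\<^sup>2 = indicator (- F) x * (norm (T \<phi> x))\<^sup>2" for x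
            by (simp add: \<psi>_def indicator_def)
          then show ?thesis using \<phi>F by simp
        qed
        have "(\<integral>x. indicator (- F') x * (norm (T (g (P k)) x))\<^sup>2 \<partial>lebesgue)
          \<le> (\<integral>x. N * K\<^sup>2 * (\<Sum>j<N. (norm (\<psi> (x - real j *\<^sub>R \<beta>)))\<^sup>2) \<partial>lebesgue)"
        proof (rule integral_mono_AE)
          show "integrable lebesgue (\<lambda>x. indicator (- F') x * (norm (T (g (P k)) x))\<^sup>2)"
            by (rule integral_indicator_norm_square(1)[OF unitary_L2_mem[OF T g] F's])
          show "integrable lebesgue (\<lambda>x. N * K\<^sup>2 * (\<Sum>j<N. (norm (\<psi> (x - real j *\<^sub>R \<beta>)))\<^sup>2))"
            by (intro integrable_mult_right Bochner_Integration.integrable_sum L2_integrable L2_translate \<psi>)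
          show "AE x in lebesgue. indicator (- F') x * (norm (T (g (P k)) x))\<^sup>2
            \<le> N * K\<^sup>2 * (\<Sum>j<N. (norm (\<psi> (x - real j *\<^sub>R \<beta>)))\<^sup>2)"
            using ae1 ae2
          proof eventually_elim
            case (elim x)
            show ?case
            proof (cases "x \<in> F'")
              case True
              have "0 \<le> N * K\<^sup>2 * (\<Sum>j<N. (norm (\<psi> (x - real j *\<^sub>R \<beta>)))\<^sup>2)"
                by (intro mult_nonneg_nonneg sum_nonneg) auto
              then show ?thesis using True by simp
            next
              case False
              have nT: "norm (T (f j) x) = norm (\<psi> (x - real j *\<^sub>R \<beta>))" if "j < N" for j
              proof -
                have "x - real j *\<^sub>R \<beta> \<notin> F"
                proof
                  assume "x - real j *\<^sub>R \<beta> \<in> F"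
                  then have "x \<in> (+) (real j *\<^sub>R \<beta>) ` F"
                    by (intro image_eqI[of _ _ "x - real j *\<^sub>R \<beta>"]) auto
                  then show False using False that by (auto simp: F'_def)
                qed
                then show ?thesis using elim(2) that by (simp add: norm_schroedinger_rep pos_S \<psi>_def)
              qed
              have "(norm (T (g (P k)) x))\<^sup>2 \<le> N * K\<^sup>2 * (\<Sum>j<N. (norm (T (f j) x))\<^sup>2)"
                unfolding elim(1) by (rule norm_sum_mult_square_le[OF P(2)[OF k]])
              also have "(\<Sum>j<N. (norm (T (f j) x))\<^sup>2) = (\<Sum>j<N. (norm (\<psi> (x - real j *\<^sub>R \<beta>)))\<^sup>2)"
                by (intro sum.cong refl) (simp add: nT)
              finally show ?thesis using False by simp
            qed
          qed
        qed
        also have "\<dots> = N * K\<^sup>2 * (\<Sum>j<N. (\<integral>x. (norm (\<psi> (x - real j *\<^sub>R \<beta>)))\<^sup>2 \<partial>lebesgue))"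
          by (subst integral_mult_right_zero, subst Bochner_Integration.integral_sum)
             (intro L2_integrable L2_translate \<psi> refl)+
        \<comment> \<open>One factor \<open>N\<close> comes from Cauchy-Schwarz for a sum of
          \<open>N\<close> terms, the other from the \<open>N\<close> translates, which all have the
          norm of \<psi>.\<close>
        also have "\<dots> = (N * K)\<^sup>2 * (\<integral>x. (norm (\<psi> x))\<^sup>2 \<partial>lebesgue)"
          unfolding L2_norm_square_translate[OF \<psi>] by (simp add: power2_eq_square)
        also have "\<dots> \<le> (N * K)\<^sup>2 * \<epsilon>" using \<psi>n by (intro mult_left_mono) auto
        finally show ?thesis using \<epsilon>6 by linarith
      qed
      have "real N \<le> 4 * c * a * measure lebesgue F'"
        unfolding a_def
        by (rule card_concentrated_orthonormal_le[OF T d E F'(1), where u="\<lambda>k. g (P k)"])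
           (use g P(3) uE uF in auto)
      also have "\<dots> \<le> 4 * c * a * (b + 1)" using F'(2) c a by (intro mult_left_mono) auto
      finally show False using N by simp
    qed
  qed
qed

theorem theorem4p1:
  fixes S :: "real ^ ('n::finite + 'n) ^ ('n + 'n)"
    and T :: "(real ^ 'n \<Rightarrow> complex) \<Rightarrow> (real ^ 'n \<Rightarrow> complex)"
    and E F :: "(real ^ 'n) set"
  assumes "symplectic S"
    and "free_matrix S"
    and "metaplectic S T"
    and "E \<in> lmeasurable"
    and "F \<in> lmeasurable"
  shows "\<exists>C::real. \<forall>\<phi>\<in>L2.
    L2_norm \<phi> \<le> C * (L2_norm (\<lambda>x. indicator (- E) x * \<phi> x) + L2_norm (\<lambda>x. indicator (- F) x * T \<phi> x))"
proof -
  have T: "unitary_L2 T" using assms(3) by (simp add: metaplectic_def)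
  obtain \<epsilon> where \<epsilon>: "\<epsilon> > 0" and conc: "\<And>\<phi>. \<phi> \<in> L2 \<Longrightarrow> (\<integral>x. (norm (\<phi> x))\<^sup>2 \<partial>lebesgue) = 1 \<Longrightarrow>
    \<epsilon> < (\<integral>x. indicator (- E) x * (norm (\<phi> x))\<^sup>2 \<partial>lebesgue) \<or>
    \<epsilon> < (\<integral>x. indicator (- F) x * (norm (T \<phi> x))\<^sup>2 \<partial>lebesgue)"
    using no_concentration[OF assms(2-5)] by blast
  have ind: "L2_norm (\<lambda>x. indicator A x * f x) = sqrt (\<integral>x. indicator A x * (norm (f x))\<^sup>2 \<partial>lebesgue)"
    for A and f :: "real ^ 'n \<Rightarrow> complex"
    unfolding L2_norm_def
    by (intro arg_cong[where f=sqrt] Bochner_Integration.integral_cong refl) (simp add: indicator_def)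
  show ?thesis
  \<comment> \<open>\<epsilon> ||\<phi>||^2 is at most the larger of the two outside masses
    \<open>e\<close> and \<open>f\<close>, hence at most (sqrt e + sqrt f)^2; taking roots yields
    this constant.\<close>
  proof (intro exI[of _ "1 / sqrt \<epsilon>"] ballI)
    fix \<phi> :: "real ^ 'n \<Rightarrow> complex" assume \<phi>: "\<phi> \<in> L2"
    define e where "e = (\<integral>x. indicator (- E) x * (norm (\<phi> x))\<^sup>2 \<partial>lebesgue)"
    define f where "f = (\<integral>x. indicator (- F) x * (norm (T \<phi> x))\<^sup>2 \<partial>lebesgue)"
    define n where "n = (\<integral>x. (norm (\<phi> x))\<^sup>2 \<partial>lebesgue)"
    have e: "e \<ge> 0" and f: "f \<ge> 0" and n: "n \<ge> 0" by (auto simp: e_def f_def n_def)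
    have "\<epsilon> * n \<le> e \<or> \<epsilon> * n \<le> f"
    proof (cases "n = 0")
      case True
      then show ?thesis using e by simp
    next
      case False
      then have n0: "n > 0" using n by simp
      \<comment> \<open>Normalises \<phi>; by homogeneity both outside masses are multiplied by the
        square of \<open>r\<close>.\<close>
      define r where "r = 1 / sqrt n"
      have r2: "r\<^sup>2 = 1 / n" using n0 by (simp add: r_def power_divide)
      define \<psi> where "\<psi> = (\<lambda>x. complex_of_real r * \<phi> x)"
      have \<psi>: "\<psi> \<in> L2" unfolding \<psi>_def by (rule L2_cmult[OF \<phi>])
      have np: "(norm (\<psi> x))\<^sup>2 = r\<^sup>2 * (norm (\<phi> x))\<^sup>2" for x
        by (simp add: \<psi>_def norm_mult power_mult_distrib)
      have 1: "(\<integral>x. (norm (\<psi> x))\<^sup>2 \<partial>lebesgue) = 1"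
        using n0 by (simp add: np r2 n_def[symmetric])
      have 2: "(\<integral>x. indicator (- E) x * (norm (\<psi> x))\<^sup>2 \<partial>lebesgue) = r\<^sup>2 * e"
        unfolding np e_def by (simp add: mult.left_commute[of _ "r\<^sup>2"])
      have 3: "(\<integral>x. indicator (- F) x * (norm (T \<psi> x))\<^sup>2 \<partial>lebesgue) = r\<^sup>2 * f"
      proof -
        have nF: "- F \<in> sets lebesgue"
          using assms(5) by (simp add: Compl_in_sets_lebesgue fmeasurableD)
        have "(\<integral>x. indicator (- F) x * (norm (T \<psi> x))\<^sup>2 \<partial>lebesgue)
          = (\<integral>x. r\<^sup>2 * (indicator (- F) x * (norm (T \<phi> x))\<^sup>2) \<partial>lebesgue)"
        proof (rule integral_cong_AE)
          show "AE x in lebesgue. indicator (- F) x * (norm (T \<psi> x))\<^sup>2 = r\<^sup>2 * (indicator (- F) x * (norm (T \<phi> x))\<^sup>2)"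
            using unitary_cmult[OF T \<phi>, of "complex_of_real r"]
            unfolding \<psi>_def by eventually_elim (simp add: norm_mult power_mult_distrib)
        qed (use integral_indicator_norm_square(1)[OF unitary_L2_mem[OF T \<psi>] nF]
               integral_indicator_norm_square(1)[OF unitary_L2_mem[OF T \<phi>] nF] in auto)
        then show ?thesis by (simp add: f_def)
      qed
      have "\<epsilon> < r\<^sup>2 * e \<or> \<epsilon> < r\<^sup>2 * f" using conc[OF \<psi> 1] unfolding 2 3 .
      then show ?thesis unfolding r2 using n0 by (auto simp: field_simps)
    qed
    then have "\<epsilon> * n \<le> (sqrt e + sqrt f)\<^sup>2"
    proof -
      have "e \<le> (sqrt e + sqrt f)\<^sup>2" "f \<le> (sqrt e + sqrt f)\<^sup>2"
        using e f by (simp_all add: power2_sum)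
      then show ?thesis using \<open>\<epsilon> * n \<le> e \<or> \<epsilon> * n \<le> f\<close> by linarith
    qed
    then have "sqrt (\<epsilon> * n) \<le> sqrt e + sqrt f"
      using e f by (intro real_le_lsqrt) auto
    then have "sqrt n \<le> 1 / sqrt \<epsilon> * (sqrt e + sqrt f)"
      using \<epsilon> by (simp add: real_sqrt_mult field_simps)
    then show "L2_norm \<phi> \<le> 1 / sqrt \<epsilon> * (L2_norm (\<lambda>x. indicator (- E) x * \<phi> x) + L2_norm (\<lambda>x. indicator (- F) x * T \<phi> x))"
      unfolding ind e_def f_def n_def by (simp add: L2_norm_def)
  qed
qed

end
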